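(* Let $L=\mathbb{Q}(\omega)$ be a real quadratic field with ring of integers $\mathcal{O}_L=\mathbb{Z}[\omega]$, let $p$ be a rational prime that splits as $p\mathcal{O}_L=\mathfrak{p}\overline{\mathfrak{p}}$ with $\mathfrak{p}\ne\overline{\mathfrak{p}}$, and fix the embedding $\iota_{\mathfrak{p}}:\mathcal{O}_L\to\mathbb{Z}_p$ corresponding to $\mathfrak{p}$. Let $d\ge2$ and let $V=(v_1,\ldots,v_d)$ be a $\mathfrak{p}$-admissible rational projective coefficient configuration of size $d$. Let $\mathcal{P}_m=\mathcal{P}_m(L,\mathfrak{p},V)\subset[0,1)^d$, $m\ge1$, be the associated rank-1 lattice point sets. Then these point sets are nested, i.e. $\mathcal{P}_m\subset\mathcal{P}_{m+1}$ as unlabeled point sets for all $m\ge1$, and all of their two-dimensional coordinate projections are quasi-uniform in the Euclidean unit square, uniformly over $m$. More precisely, for all $m\ge1$ and $1\le i<j\le d$, \[ q_{ij}(\mathcal{P}_m)\ge\frac{1}{2\sqrt{D_{ij}}}\,p^{-m/2}, \] \[ h_{ij}(\mathcal{P}_m)\le\frac{(1+\sqrt2)\,\eta A_{ij}(\eta+A_{ij})}{2}\,p^{-m/2}, \] \[ \rho_{ij}(\mathcal{P}_m)\le(1+\sqrt2)A_{ij}(\eta+A_{ij}), \] where $\eta=(2/\sqrt3)^{1/2}$, $D_{ij}=\prod_{\ell=1}^2\left(|\sigma_\ell(\beta_i)|+|\sigma_\ell(\beta_j)|\right)$ and $A_{ij}=2\sqrt{D_{ij}}/\sqrt3$. In particular,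 \[ \sup_{m\ge1}\max_{1\le i<j\le d}\rho_{ij}(\mathcal{P}_m)<\infty . \]
   Context: A rational projective coefficient configuration of size $d$ is an ordered tuple $V=(v_1,\ldots,v_d)$ of pairwise distinct points $v_j=[a_j:b_j]\in\mathbb{P}^1(\mathbb{Q})$, each represented by its canonical primitive integer representative: $a_j,b_j\in\mathbb{Z}$, $\gcd(a_j,b_j)=1$, and either $a_j>0$ or $(a_j,b_j)=(0,1)$. Put $\beta_j=a_j+b_j\omega\in\mathcal{O}_L$. The maps $\sigma_1,\sigma_2:L\to\mathbb{R}$ are the two real embeddings of $L$. The embedding $\iota_{\mathfrak{p}}:\mathcal{O}_L\to\mathbb{Z}_p$ is the ring homomorphism obtained from the completion $L_{\mathfrak{p}}\cong\mathbb{Q}_p$. Its reduction modulo $p^m$ is the ring homomorphism $\iota_m:\mathcal{O}_L\to\mathbb{Z}/p^m\mathbb{Z}$, whose kernel is $\mathfrak{p}^m$. The configuration $V$ is $\mathfrak{p}$-admissible if $\beta_j\notin\mathfrak{p}$ for all $j$ (equivalently $\iota_{\mathfrak{p}}(\beta_j)\in\mathbb{Z}_p^\times$ for all $j$). Let $z_{m,j}\in\{0,1,\ldots,p^m-1\}$ be the standard representative of $\iota_m(\beta_j)$, $\boldsymbol{z}_m=(z_{m,1},\ldots,z_{m,d})$, and \[ \mathcal{P}_m(L,\mathfrak{p},V)=\left\{\left\{n\boldsymbol{z}_m/p^m\right\}\mid 0\le n<p^m\right\}\subset[0,1)^d, \] regarded as a family indexed by $n$, where $\{\cdot\}$ applied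 to a vector is the componentwise fractional part. For a finite indexed family $P=(\boldsymbol{y}_n)_{n=0}^{N-1}\subset[0,1)^s$ (repetitions retained), define \[ h(P)=\sup_{\boldsymbol{y}\in[0,1)^s}\min_{0\le n<N}\|\boldsymbol{y}-\boldsymbol{y}_n\|_2,\quad q(P)=\tfrac12\min_{0\le m<n<N}\|\boldsymbol{y}_m-\boldsymbol{y}_n\|_2,\quad \rho(P)=h(P)/q(P), \] with $q(P)=0$ and $\rho(P)=\infty$ if two labeled points coincide. For $P\subset[0,1)^d$ and $i<j$, $h_{ij}(P),q_{ij}(P),\rho_{ij}(P)$ denote these quantities for the indexed projection of $P$ onto coordinates $i$ and $j$. A sequence of finite families is quasi-uniform if its mesh ratios $\rho$ are bounded. *)

theory Defs
  imports
    "HOL-Analysis.Analysis"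
    "HOL-Algebra.Algebra"
    "HOL-Algebra.Algebraic_Closure_Type"
begin

section \<open>Quadratic fields\<close>

text \<open>The number field \<open>L\<close> is the whole of a type \<open>'l\<close> of class \<^class>\<open>field_char_0\<close>;
  \<^const>\<open>ring_of_type_algebra\<close> is that field as a record.\<close>

abbreviation type_ring :: "'l::field_char_0 ring" where
  "type_ring \<equiv> ring_of_type_algebra"

definition real_embeddings :: "('l::field_char_0 \<Rightarrow> real) set" where
  "real_embeddings = ring_hom type_ring type_ring"

definition real_quadratic_field :: "'l::field_char_0 itself \<Rightarrow> bool" where
  "real_quadratic_field _ \<longleftrightarrow>
     vector_space.dim (\<lambda>(q::rat) (x::'l). of_rat q * x) UNIV = 2 \<and>
     (real_embeddings :: ('l \<Rightarrow> real) set) \<noteq> {}"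

definition ring_of_integers :: "'l::field_char_0 ring" where
  "ring_of_integers = type_ring\<lparr>carrier := {x. algebraic_int x}\<rparr>"

definition nontrivial_automorphism :: "('l::field_char_0 \<Rightarrow> 'l) \<Rightarrow> bool" where
  "nontrivial_automorphism \<tau> \<longleftrightarrow> \<tau> \<in> ring_iso type_ring type_ring \<and> \<tau> \<noteq> id"

section \<open>Adic completions and $p$-adic integers\<close>

definition ideal_pow :: "('a, 'b) ring_scheme \<Rightarrow> 'a set \<Rightarrow> nat \<Rightarrow> 'a set" where
  "ideal_pow R I m = I [^]\<^bsub>ideals_set R\<^esub> m"

text \<open>The inverse limit of the rings \<open>R / I\<^sup>m\<close>. Elements of \<open>R / I\<^sup>m\<close> are cosets, and the
  transition map sends a coset of \<open>I\<^sup>m\<^sup>+\<^sup>1\<close> to the coset of \<open>I\<^sup>m\<close> that contains it.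
  For a nonzero prime \<open>I\<close> of the ring of integers of \<open>L\<close> this is the valuation ring of the
  completion of \<open>L\<close> at \<open>I\<close>.\<close>

definition adic_completion :: "('a, 'b) ring_scheme \<Rightarrow> 'a set \<Rightarrow> (nat \<Rightarrow> 'a set) ring" where
  "adic_completion R I =
     \<lparr> carrier = {x. \<forall>m. x m \<in> carrier (R Quot (ideal_pow R I m)) \<and> x (Suc m) \<subseteq> x m},
       monoid.mult = (\<lambda>x y m. x m \<otimes>\<^bsub>R Quot (ideal_pow R I m)\<^esub> y m),
       one = (\<lambda>m. \<one>\<^bsub>R Quot (ideal_pow R I m)\<^esub>),
       ring.zero = (\<lambda>m. \<zero>\<^bsub>R Quot (ideal_pow R I m)\<^esub>),
       add = (\<lambda>x y m. x m \<oplus>\<^bsub>R Quot (ideal_pow R I m)\<^esub> y m) \<rparr>"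

definition completion_map :: "('a, 'b) ring_scheme \<Rightarrow> 'a set \<Rightarrow> 'a \<Rightarrow> nat \<Rightarrow> 'a set" where
  "completion_map R I x = (\<lambda>m. ideal_pow R I m +>\<^bsub>R\<^esub> x)"

text \<open>\<open>\<int>\<^sub>p\<close> as the inverse limit of the rings \<open>\<int>/p\<^sup>m\<int>\<close>; the component \<open>x m\<close> is the standard
  representative in \<open>{0..<p\<^sup>m}\<close> of the reduction of \<open>x\<close> modulo \<open>p\<^sup>m\<close>.\<close>

definition padic_integers :: "nat \<Rightarrow> (nat \<Rightarrow> int) ring" where
  "padic_integers p =
     \<lparr> carrier = {x. \<forall>m. x m \<in> {0..<int p ^ m} \<and> x (Suc m) mod int p ^ m = x m},
       monoid.mult = (\<lambda>x y m. (x m * y m) mod int p ^ m),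
       one = (\<lambda>m. 1 mod int p ^ m),
       ring.zero = (\<lambda>m. 0),
       add = (\<lambda>x y m. (x m + y m) mod int p ^ m) \<rparr>"

lemma cring_padic_integers:
  assumes "p > 0"
  shows "cring (padic_integers p)"
proof -
  have pos: "int p ^ m > 0" for m using assms by simp
  have red: "a mod int p ^ Suc m mod int p ^ m = a mod int p ^ m" for a m
    by (rule mod_mod_cancel) simp
  have carr: "x \<in> carrier (padic_integers p) \<longleftrightarrow>
      (\<forall>m. x m mod int p ^ m = x m \<and> x (Suc m) mod int p ^ m = x m)" for x
    using pos by (auto simp: padic_integers_def) (metis pos_mod_sign pos, metis pos_mod_bound pos)
  have pick: "(\<lambda>m. f m mod int p ^ m) \<in> carrier (padic_integers p)"
    if "\<And>m. f (Suc m) mod int p ^ m = f m mod int p ^ m" for f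
    unfolding carr using that by (simp only: red mod_mod_trivial simp_thms)
  have cl: "(\<lambda>m. (x m + y m) mod int p ^ m) \<in> carrier (padic_integers p)"
      "(\<lambda>m. (x m * y m) mod int p ^ m) \<in> carrier (padic_integers p)"
      "(\<lambda>m. (- x m) mod int p ^ m) \<in> carrier (padic_integers p)"
    if "x \<in> carrier (padic_integers p)" "y \<in> carrier (padic_integers p)" for x y
    using that unfolding carr[of x] carr[of y]
    by (intro pick; metis mod_add_eq mod_mult_eq mod_minus_eq)+
  have ops: "x \<oplus>\<^bsub>padic_integers p\<^esub> y = (\<lambda>m. (x m + y m) mod int p ^ m)"
      "x \<otimes>\<^bsub>padic_integers p\<^esub> y = (\<lambda>m. (x m * y m) mod int p ^ m)"
      "\<zero>\<^bsub>padic_integers p\<^esub> = (\<lambda>m. 0)" "\<one>\<^bsub>padic_integers p\<^esub> = (\<lambda>m. 1 mod int p ^ m)" for x y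
    by (simp_all add: padic_integers_def)
  have one: "(\<lambda>m. 1 mod int p ^ m) \<in> carrier (padic_integers p)" by (rule pick) simp
  have zero: "(\<lambda>m. 0) \<in> carrier (padic_integers p)" by (simp add: carr)
  have id: "x m mod int p ^ m = x m" if "x \<in> carrier (padic_integers p)" for x m
    using that by (simp add: carr)
  show ?thesis
  proof (intro cringI abelian_groupI comm_monoidI, goal_cases)
    case (6 x)
    then show ?case
      by (intro bexI[OF _ cl(3)]) (auto simp: ops mod_simps)
  qed (simp_all add: ops cl one zero mod_simps id algebra_simps)
qed

text \<open>The embedding obtained from the completion at \<open>P\<close>, where \<open>\<phi>\<close> identifies the completed
  ring with \<open>\<int>\<^sub>p\<close>.\<close>

definition padic_embedding ::
    "'l::field_char_0 set \<Rightarrow> ((nat \<Rightarrow> 'l set) \<Rightarrow> nat \<Rightarrow> int) \<Rightarrow> 'l \<Rightarrow> nat \<Rightarrow> int" where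
  "padic_embedding P \<phi> x = \<phi> (completion_map ring_of_integers P x)"

section \<open>Rational projective coefficient configurations\<close>

definition proj_rel :: "((rat \<times> rat) \<times> (rat \<times> rat)) set" where
  "proj_rel = {((x, y), (x', y')). (x, y) \<noteq> (0, 0) \<and> (x', y') \<noteq> (0, 0) \<and>
                 (\<exists>c. c \<noteq> 0 \<and> x' = c * x \<and> y' = c * y)}"

definition proj_line_rat :: "(rat \<times> rat) set set" where
  "proj_line_rat = (UNIV - {(0, 0)}) // proj_rel"

definition proj_point :: "rat \<Rightarrow> rat \<Rightarrow> (rat \<times> rat) set" where
  "proj_point x y = proj_rel `` {(x, y)}"

definition is_canonical_rep :: "(rat \<times> rat) set \<Rightarrow> int \<times> int \<Rightarrow> bool" where
  "is_canonical_rep v = (\<lambda>(a, b). gcd a b = 1 \<and> (a > 0 \<or> (a, b) = (0, 1)) \<and>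
                           v = proj_point (of_int a) (of_int b))"

lemma ex1_canonical_rep:
  assumes "v \<in> proj_line_rat"
  shows "\<exists>!ab. is_canonical_rep v ab"
proof -
  have eqv: "equiv (UNIV - {(0, 0)}) proj_rel"
  proof (rule equivI)
    show "proj_rel \<subseteq> (UNIV - {(0, 0)}) \<times> (UNIV - {(0, 0)})"
      by (auto simp: proj_rel_def)
    show "refl_on (UNIV - {(0, 0)}) proj_rel"
      by (auto simp: refl_on_def proj_rel_def intro: exI[of _ 1])
    show "sym proj_rel"
    proof (rule symI)
      fix u v assume "(u, v) \<in> proj_rel"
      then obtain c where c: "u \<noteq> (0, 0)" "v \<noteq> (0, 0)" "c \<noteq> 0" "fst v = c * fst u" "snd v = c * snd u"
        by (auto simp: proj_rel_def)
      then show "(v, u) \<in> proj_rel"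
        by (cases u; cases v) (auto simp: proj_rel_def intro!: exI[of _ "inverse c"])
    qed
    show "trans proj_rel"
    proof (rule transI)
      fix u v w assume uv: "(u, v) \<in> proj_rel" and vw: "(v, w) \<in> proj_rel"
      obtain c where "u \<noteq> (0, 0)" "c \<noteq> 0" "fst v = c * fst u" "snd v = c * snd u"
        using uv by (auto simp: proj_rel_def)
      moreover obtain c' where "w \<noteq> (0, 0)" "c' \<noteq> 0" "fst w = c' * fst v" "snd w = c' * snd v"
        using vw by (auto simp: proj_rel_def)
      ultimately show "(u, w) \<in> proj_rel"
        by (cases u; cases w) (auto simp: proj_rel_def intro!: exI[of _ "c' * c"])
    qed
  qed
  have point_eq: "proj_point x y = proj_point x' y' \<longleftrightarrow> ((x, y), (x', y')) \<in> proj_rel"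
    if "(x, y) \<noteq> (0, 0)" "(x', y') \<noteq> (0, 0)" for x y x' y'
    unfolding proj_point_def using that by (intro eq_equiv_class_iff[OF eqv]) auto
  obtain x y where xy: "(x, y) \<noteq> (0, 0)" "v = proj_point x y"
    using assms unfolding proj_line_rat_def proj_point_def by (auto elim!: quotientE)
  obtain a b c where abc: "gcd a b = 1" "a > 0 \<or> (a, b) = (0, 1)"
    "c \<noteq> 0" "of_int a = c * x" "of_int b = c * y"
  proof -
    obtain m k where mk: "k > 0" "x = of_int m / of_int k"
      by (metis Rat_cases Fract_of_int_quotient)
    obtain n l where nl: "l > 0" "y = of_int n / of_int l"
      by (metis Rat_cases Fract_of_int_quotient)
    define g where "g = gcd (m * l) (n * k)"
    define s where "s = (if m * l > 0 \<or> m * l = 0 \<and> n * k > 0 then 1 else (-1::int))"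
    have nz: "m * l \<noteq> 0 \<or> n * k \<noteq> 0" using xy mk nl by auto
    have g: "g > 0" using nz by (auto simp: g_def)
    define a where "a = s * (m * l div g)"
    define b where "b = s * (n * k div g)"
    have da: "s * (m * l) = a * g" "s * (n * k) = b * g"
      by (auto simp: a_def b_def g_def)
    have s: "s = 1 \<or> s = -1" by (auto simp: s_def)
    have cop: "gcd a b = 1"
      using div_gcd_coprime[of "m * l" "n * k"] nz s by (auto simp: a_def b_def g_def)
    have sgn: "a > 0 \<or> (a, b) = (0, 1)"
    proof (cases "m * l = 0")
      case True
      then have a0: "a = 0" unfolding a_def by (metis div_0 mult_zero_right)
      have "s * (n * k) > 0" using True nz by (auto simp: s_def)
      then have "b > 0" using da g by (simp add: zero_less_mult_iff)
      then show ?thesis using cop a0 by simp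
    next
      case False
      then have "s * (m * l) > 0" by (auto simp: s_def)
      then show ?thesis using da g by (simp add: zero_less_mult_iff)
    qed
    define c :: rat where "c = of_int s * of_int k * of_int l / of_int g"
    have "c \<noteq> 0" using s mk nl g by (auto simp: c_def)
    moreover have "of_int a = c * x"
    proof -
      have "c * x = of_int (s * (m * l)) / of_int g" using mk by (simp add: c_def)
      then show ?thesis using da g by simp
    qed
    moreover have "of_int b = c * y"
    proof -
      have "c * y = of_int (s * (n * k)) / of_int g" using nl by (simp add: c_def)
      then show ?thesis using da g by simp
    qed
    ultimately show ?thesis by (rule that[OF cop sgn])
  qed
  have "v = proj_point (of_int a) (of_int b)"
    unfolding xy(2) using abc xy(1) by (subst point_eq) (auto simp: proj_rel_def)
  then have ex: "is_canonical_rep v (a, b)" using abc by (simp add: is_canonical_rep_def)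
  have uniq: "a1 = a2 \<and> b1 = b2"
    if h1: "is_canonical_rep v (a1, b1)" and h2: "is_canonical_rep v (a2, b2)"
    for a1 b1 a2 b2
  proof -
    have s1: "a1 > 0 \<or> a1 = 0 \<and> b1 = 1" and s2: "a2 > 0 \<or> a2 = 0 \<and> b2 = 1"
      using h1 h2 by (simp_all add: is_canonical_rep_def)
    have "(of_int a1 :: rat, of_int b1 :: rat) \<noteq> (0, 0)"
      "(of_int a2 :: rat, of_int b2 :: rat) \<noteq> (0, 0)"
      using h1 h2 by (auto simp: is_canonical_rep_def)
    moreover have "proj_point (of_int a1) (of_int b1) = proj_point (of_int a2) (of_int b2)"
      using h1 h2 by (simp add: is_canonical_rep_def)
    ultimately obtain c :: rat where c: "c \<noteq> 0" "of_int a2 = c * of_int a1" "of_int b2 = c * of_int b1"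
      by (auto simp: point_eq proj_rel_def)
    have "of_int (a1 * b2) = (of_int (a2 * b1) :: rat)" using c by simp
    then have cross: "a1 * b2 = a2 * b1" by (simp only: of_int_eq_iff)
    have c1: "coprime a1 b1" "coprime a2 b2"
      using h1 h2 by (auto simp: is_canonical_rep_def coprime_iff_gcd_eq_1)
    have "a1 dvd a2" "a2 dvd a1"
      using cross c1 by (metis coprime_dvd_mult_left_iff dvd_triv_left)+
    moreover have "a1 \<ge> 0" "a2 \<ge> 0"
      using s1 s2 by linarith+
    ultimately have eq: "a1 = a2" by (intro zdvd_antisym_nonneg)
    moreover have "b1 = b2"
      using cross eq s1 s2 by (cases "a1 = 0") auto
    ultimately show ?thesis by simp
  qed
  show ?thesis
  proof (rule ex1I[of _ "(a, b)"])
    show "is_canonical_rep v (a, b)" by (fact ex)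
  next
    fix ab assume "is_canonical_rep v ab"
    then show "ab = (a, b)" using uniq[OF _ ex] by (cases ab) auto
  qed
qed

definition canonical_rep :: "(rat \<times> rat) set \<Rightarrow> int \<times> int" where
  "canonical_rep v = (THE ab. is_canonical_rep v ab)"

definition coeff_configuration :: "('d \<Rightarrow> (rat \<times> rat) set) \<Rightarrow> bool" where
  "coeff_configuration V \<longleftrightarrow> range V \<subseteq> proj_line_rat \<and> inj V"

definition config_beta :: "'l::field_char_0 \<Rightarrow> ('d \<Rightarrow> (rat \<times> rat) set) \<Rightarrow> 'd \<Rightarrow> 'l" where
  "config_beta \<omega> V j = (case canonical_rep (V j) of (a, b) \<Rightarrow> of_int a + of_int b * \<omega>)"

definition admissible ::
    "'l::field_char_0 \<Rightarrow> 'l set \<Rightarrow> ('d \<Rightarrow> (rat \<times> rat) set) \<Rightarrow> bool" where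
  "admissible \<omega> P V \<longleftrightarrow> (\<forall>j. config_beta \<omega> V j \<notin> P)"

section \<open>Rank-1 lattice point sets\<close>

text \<open>A finite indexed family of points is a function on \<open>nat\<close> together with its length \<open>N\<close>;
  only the values at \<open>n < N\<close> matter.\<close>

definition rank1_lattice :: "nat \<Rightarrow> ('d \<Rightarrow> int) \<Rightarrow> nat \<Rightarrow> real ^ 'd::finite" where
  "rank1_lattice N z n = (\<chi> j. frac (of_int (int n * z j) / of_nat N))"

definition quadratic_points ::
    "nat \<Rightarrow> 'l::field_char_0 \<Rightarrow> 'l set \<Rightarrow> ((nat \<Rightarrow> 'l set) \<Rightarrow> nat \<Rightarrow> int) \<Rightarrow>
     ('d \<Rightarrow> (rat \<times> rat) set) \<Rightarrow> nat \<Rightarrow> nat \<Rightarrow> real ^ 'd::finite" where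
  "quadratic_points p \<omega> P \<phi> V m =
     rank1_lattice (p ^ m) (\<lambda>j. padic_embedding P \<phi> (config_beta \<omega> V j) m)"

definition coord_proj :: "'d \<Rightarrow> 'd \<Rightarrow> (nat \<Rightarrow> real ^ 'd::finite) \<Rightarrow> nat \<Rightarrow> real \<times> real" where
  "coord_proj i j Y = (\<lambda>n. (Y n $ i, Y n $ j))"

section \<open>Fill distance, separation radius, mesh ratio\<close>

definition half_open_cube :: "'a::euclidean_space set" where
  "half_open_cube = {y. \<forall>b\<in>Basis. 0 \<le> y \<bullet> b \<and> y \<bullet> b < 1}"

definition fill_distance :: "nat \<Rightarrow> (nat \<Rightarrow> 'a::euclidean_space) \<Rightarrow> real" where
  "fill_distance N Y = (SUP y\<in>half_open_cube. Min ((\<lambda>n. norm (y - Y n)) ` {..<N}))"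

text \<open>\<open>Min\<close> is taken over a nonempty set only for \<open>N \<ge> 2\<close>, and the separation radius and the
  mesh ratio are meant for such families only.\<close>

definition separation_radius :: "nat \<Rightarrow> (nat \<Rightarrow> 'a::euclidean_space) \<Rightarrow> real" where
  "separation_radius N Y = 1 / 2 * Min {norm (Y k - Y n) | k n. k < n \<and> n < N}"

definition mesh_ratio :: "nat \<Rightarrow> (nat \<Rightarrow> 'a::euclidean_space) \<Rightarrow> ereal" where
  "mesh_ratio N Y =
     (if separation_radius N Y = 0 then \<infinity>
      else ereal (fill_distance N Y / separation_radius N Y))"

text \<open>Sequences of families are indexed by \<open>m \<ge> 1\<close>; the \<open>m\<close>-th family is \<open>Y m\<close>, of length
  \<open>N m\<close>.\<close>

definition quasi_uniform :: "(nat \<Rightarrow> nat) \<Rightarrow> (nat \<Rightarrow> nat \<Rightarrow> 'a::euclidean_space) \<Rightarrow> bool" where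
  "quasi_uniform N Y \<longleftrightarrow> (\<exists>C::real. \<forall>m\<ge>1. mesh_ratio (N m) (Y m) \<le> ereal C)"

section \<open>The constants of the bounds\<close>

definition eta :: real where
  "eta = (2 / sqrt 3) powr (1 / 2)"

definition D_const :: "(nat \<Rightarrow> 'l \<Rightarrow> real) \<Rightarrow> ('d \<Rightarrow> 'l) \<Rightarrow> 'd \<Rightarrow> 'd \<Rightarrow> real" where
  "D_const \<sigma> \<beta> i j = (\<Prod>l=1..2. \<bar>\<sigma> l (\<beta> i)\<bar> + \<bar>\<sigma> l (\<beta> j)\<bar>)"

definition A_const :: "(nat \<Rightarrow> 'l \<Rightarrow> real) \<Rightarrow> ('d \<Rightarrow> 'l) \<Rightarrow> 'd \<Rightarrow> 'd \<Rightarrow> real" where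
  "A_const \<sigma> \<beta> i j = 2 * sqrt (D_const \<sigma> \<beta> i j) / sqrt 3"

end

theory Submission
  imports Defs
begin

text \<open>
  Write \<open>N = p\<^sup>m\<close> and let \<open>\<theta>\<^sub>m\<close> be the composite of \<open>\<O>\<^sub>L \<rightarrow> \<int>\<^sub>p\<close> with reduction modulo \<open>N\<close>.
  The projection of the point set to the coordinates \<open>i, j\<close> consists, after scaling by \<open>N\<close>, of the
  points in \<open>[0, N)\<^sup>2\<close> of the planar lattice \<open>\<Lambda>\<close> of all \<open>(u, v)\<close> with
  \<open>u \<equiv> k \<theta>\<^sub>m(\<beta>\<^sub>i)\<close> and \<open>v \<equiv> k \<theta>\<^sub>m(\<beta>\<^sub>j)\<close> modulo \<open>N\<close> for some \<open>k\<close>. Everything follows from a lower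
  bound for the nonzero vectors of \<open>\<Lambda>\<close>.

  \<^bold>\<open>Arithmetic.\<close> If \<open>(u, v) \<in> \<Lambda>\<close>, then \<open>x = u \<beta>\<^sub>j - v \<beta>\<^sub>i\<close> satisfies \<open>\<theta>\<^sub>m(x) = 0\<close>. Multiplying by the
  conjugate of \<open>x\<close>, which lies in \<open>\<O>\<^sub>L\<close>, gives \<open>\<theta>\<^sub>m\<close> of an integer, namely of the norm of \<open>x\<close>, and
  \<open>\<theta>\<^sub>m\<close> is the ordinary reduction on integers; so \<open>N\<close> divides the norm
  \<open>\<sigma>\<^sub>1(x) \<sigma>\<^sub>2(x)\<close>. For distinct projective points \<open>\<beta>\<^sub>i\<close> and \<open>\<beta>\<^sub>j\<close> are linearly independent over the
  rationals, so the norm is nonzero when \<open>(u, v)\<close> is, and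
  \<open>N \<le> \<bar>\<sigma>\<^sub>1(x)\<bar> \<bar>\<sigma>\<^sub>2(x)\<bar> \<le> D max(\<bar>u\<bar>, \<bar>v\<bar>)\<^sup>2\<close> (\<open>short_vector_bound\<close>). Because \<open>\<beta>\<^sub>i\<close> is not in \<open>P\<close>, its image
  in \<open>\<int>\<^sub>p\<close> is a unit (\<open>padic_embedding_nonunit\<close>); hence different labels give points that differ by a
  nonzero vector of \<open>\<Lambda>\<close>, and the separation bound is immediate (\<open>separation_radius_ge\<close>).

  \<^bold>\<open>Geometry.\<close> The lattice contains two vectors of determinant \<open>N\<close>, and Lagrange reduction turns
  them into a pair \<open>c, d\<close> with \<open>\<bar>c\<bar> \<le> \<bar>d\<bar>\<close> and \<open>\<bar>c\<bar> \<bar>d\<bar> \<le> 2 N / \<surd>3\<close>. This gives \<open>\<bar>c\<bar> \<le> \<eta> \<surd>N\<close>, and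
  with the lower bound \<open>\<bar>c\<bar> \<ge> \<surd>(N / D)\<close> also \<open>\<bar>d\<bar> \<le> A \<surd>N\<close> (\<open>short_basis\<close>). So every point of the
  plane is within \<open>R = (\<eta> + A) / (2 \<surd>N)\<close> of the lattice scaled by \<open>1 / N\<close>. Only lattice points
  inside the half-open unit square count: when \<open>R < 1/2\<close> one moves the target a distance at most \<open>\<surd>2 R\<close> into the square before
  searching for a lattice point, which explains the factor \<open>1 + \<surd>2\<close>; otherwise the origin and one
  point in the right half of the square already achieve \<open>(1 + \<surd>2) / 2 \<le> (1 + \<surd>2) R\<close> (\<open>fill_distance_lattice_le\<close>).

  The resulting estimate \<open>h \<le> (1 + \<surd>2) R\<close> is smaller than the stated one by the factor \<open>\<eta> A \<ge> 1\<close>. The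
  mesh ratio bound needs this sharper form: dividing the stated bounds for \<open>h\<close> and \<open>q\<close> by one another
  would give a larger constant (\<open>mesh_bounds_combine\<close>).
\<close>

section \<open>Lagrange reduction of planar integer lattices\<close>

definition dot2 :: "int \<times> int \<Rightarrow> int \<times> int \<Rightarrow> int" where
  "dot2 b c = fst b * fst c + snd b * snd c"

definition det2 :: "int \<times> int \<Rightarrow> int \<times> int \<Rightarrow> int" where
  "det2 b c = fst b * snd c - snd b * fst c"

lemma dot2_nonneg: "0 \<le> dot2 b b"
  by (simp add: dot2_def)

lemma lagrange_identity2: "dot2 b b * dot2 c c = (det2 b c)\<^sup>2 + (dot2 b c)\<^sup>2"
  by (simp add: dot2_def det2_def power2_eq_square algebra_simps)

text \<open>Lagrange reduction, by minimality instead of by an algorithm: among all pairs in \<open>L\<close> with the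
  given determinant take one whose sum of squared lengths is least. Adding one vector to the other
  or subtracting it preserves the determinant, hence cannot shorten the pair, and this is the
  inequality for the inner product.\<close>

lemma reduced_pair_exists:
  fixes L :: "(int \<times> int) set"
  assumes add: "\<And>x y. x \<in> L \<Longrightarrow> y \<in> L \<Longrightarrow> x + y \<in> L"
    and diff: "\<And>x y. x \<in> L \<Longrightarrow> y \<in> L \<Longrightarrow> x - y \<in> L"
    and start: "b0 \<in> L" "c0 \<in> L"
  obtains b c where "b \<in> L" "c \<in> L" "\<bar>det2 b c\<bar> = \<bar>det2 b0 c0\<bar>"
    "dot2 b b \<le> dot2 c c" "2 * \<bar>dot2 b c\<bar> \<le> dot2 b b"
proof -
  define S where "S = (\<lambda>(b, c). b \<in> L \<and> c \<in> L \<and> \<bar>det2 b c\<bar> = \<bar>det2 b0 c0\<bar>)"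
  define f where "f = (\<lambda>(b, c). nat (dot2 b b + dot2 c c))"
  have "S (b0, c0)" using start by (simp add: S_def)
  then obtain w where w: "S w" "\<And>w'. S w' \<Longrightarrow> f w \<le> f w'"
    using ex_has_least_nat[of S "(b0, c0)" f] by blast
  obtain b c where wbc: "w = (b, c)" by (cases w)
  have bc: "b \<in> L" "c \<in> L" "\<bar>det2 b c\<bar> = \<bar>det2 b0 c0\<bar>"
    using w(1) by (auto simp: S_def wbc)
  have min: "dot2 b b + dot2 c c \<le> dot2 b' b' + dot2 c' c'"
    if "b' \<in> L" "c' \<in> L" "\<bar>det2 b' c'\<bar> = \<bar>det2 b c\<bar>" for b' c'
  proof -
    have "S (b', c')" using that bc by (simp add: S_def)
    from w(2)[OF this] show ?thesis
      using dot2_nonneg[of b'] dot2_nonneg[of c'] by (simp add: f_def wbc)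
  qed
  have key: "2 * \<bar>dot2 b c\<bar> \<le> dot2 b b" "2 * \<bar>dot2 b c\<bar> \<le> dot2 c c"
  proof -
    have "det2 b (c + b) = det2 b c" "det2 b (c - b) = det2 b c"
        "det2 (b + c) c = det2 b c" "det2 (b - c) c = det2 b c"
      by (simp_all add: det2_def algebra_simps)
    then have "dot2 c c \<le> dot2 (c + b) (c + b)" "dot2 c c \<le> dot2 (c - b) (c - b)"
        "dot2 b b \<le> dot2 (b + c) (b + c)" "dot2 b b \<le> dot2 (b - c) (b - c)"
      using min[of b "c + b"] min[of b "c - b"] min[of "b + c" c] min[of "b - c" c] bc
      by (auto simp: add diff)
    moreover have "dot2 (c + b) (c + b) = dot2 c c + 2 * dot2 b c + dot2 b b"
        "dot2 (c - b) (c - b) = dot2 c c - 2 * dot2 b c + dot2 b b"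
        "dot2 (b + c) (b + c) = dot2 c c + 2 * dot2 b c + dot2 b b"
        "dot2 (b - c) (b - c) = dot2 c c - 2 * dot2 b c + dot2 b b"
      by (simp_all add: dot2_def algebra_simps)
    ultimately show "2 * \<bar>dot2 b c\<bar> \<le> dot2 b b" "2 * \<bar>dot2 b c\<bar> \<le> dot2 c c"
      by linarith+
  qed
  have sym: "dot2 c b = dot2 b c" "\<bar>det2 c b\<bar> = \<bar>det2 b c\<bar>"
    by (simp_all add: dot2_def det2_def algebra_simps)
  show ?thesis
  proof (cases "dot2 b b \<le> dot2 c c")
    case True
    then show ?thesis using that[of b c] bc key by simp
  next
    case False
    then show ?thesis using that[of c b] bc key sym by simp
  qed
qed

text \<open>By the Lagrange identity, the inner product of a reduced pair accounts for at most a quarter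
  of the product of the squared lengths.\<close>

lemma reduced_pair_product:
  assumes "dot2 b b \<le> dot2 c c" "2 * \<bar>dot2 b c\<bar> \<le> dot2 b b"
  shows "3 * (dot2 b b * dot2 c c) \<le> 4 * (det2 b c)\<^sup>2"
proof -
  have "(2 * \<bar>dot2 b c\<bar>)\<^sup>2 \<le> (dot2 b b)\<^sup>2"
    using assms(2) by (intro power_mono) auto
  also have "\<dots> \<le> dot2 b b * dot2 c c"
    unfolding power2_eq_square using assms(1) by (intro mult_left_mono dot2_nonneg)
  finally show ?thesis
    using lagrange_identity2[of b c] by (simp add: power_mult_distrib)
qed

definition int_norm :: "int \<times> int \<Rightarrow> real" where
  "int_norm b = norm (real_of_int (fst b), real_of_int (snd b))"

lemma int_norm_sq: "(int_norm b)\<^sup>2 = real_of_int (dot2 b b)"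
  by (simp add: int_norm_def dot2_def norm_Pair power2_eq_square)

text \<open>Rounding the two coordinates with respect to the basis \<open>b, c\<close> moves a point by at most half of
  each basis vector.\<close>

lemma close_lattice_point:
  fixes y :: "real \<times> real"
  assumes "det2 b c \<noteq> 0"
  obtains k l :: int where
    "norm (y - (of_int (k * fst b + l * fst c), of_int (k * snd b + l * snd c)))
       \<le> (int_norm b + int_norm c) / 2"
proof -
  define B :: "real \<times> real" where "B = (of_int (fst b), of_int (snd b))"
  define C :: "real \<times> real" where "C = (of_int (fst c), of_int (snd c))"
  define d where "d = real_of_int (det2 b c)"
  have d: "d \<noteq> 0" using assms by (simp add: d_def)
  have dd: "d = fst B * snd C - snd B * fst C"
    by (simp add: d_def det2_def B_def C_def)
  define s where "s = (fst y * snd C - snd y * fst C) / d"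
  define t where "t = (fst B * snd y - snd B * fst y) / d"
  have y: "y = s *\<^sub>R B + t *\<^sub>R C"
  proof (rule prod_eqI)
    have "d * fst y = d * fst (s *\<^sub>R B + t *\<^sub>R C)" "d * snd y = d * snd (s *\<^sub>R B + t *\<^sub>R C)"
    proof -
      have ds: "d * s = fst y * snd C - snd y * fst C" "d * t = fst B * snd y - snd B * fst y"
        using d by (simp_all add: s_def t_def)
      have "d * fst (s *\<^sub>R B + t *\<^sub>R C) = (d * s) * fst B + (d * t) * fst C"
        "d * snd (s *\<^sub>R B + t *\<^sub>R C) = (d * s) * snd B + (d * t) * snd C"
        by (simp_all add: algebra_simps)
      then show "d * fst y = d * fst (s *\<^sub>R B + t *\<^sub>R C)" "d * snd y = d * snd (s *\<^sub>R B + t *\<^sub>R C)"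
        unfolding ds by (simp_all add: dd algebra_simps)
    qed
    then show "fst y = fst (s *\<^sub>R B + t *\<^sub>R C)" "snd y = snd (s *\<^sub>R B + t *\<^sub>R C)"
      using d by (metis mult_left_cancel)+
  qed
  have "y - (of_int (round s * fst b + round t * fst c), of_int (round s * snd b + round t * snd c))
      = (s - round s) *\<^sub>R B + (t - round t) *\<^sub>R C"
    unfolding y by (rule prod_eqI) (simp_all add: B_def C_def algebra_simps)
  also have "norm \<dots> \<le> \<bar>s - round s\<bar> * norm B + \<bar>t - round t\<bar> * norm C"
    by (metis norm_scaleR norm_triangle_ineq)
  also have "\<dots> \<le> 1 / 2 * norm B + 1 / 2 * norm C"
    using of_int_round_abs_le[of s] of_int_round_abs_le[of t]
    by (intro add_mono mult_right_mono) (auto simp: abs_minus_commute)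
  also have "\<dots> = (int_norm b + int_norm c) / 2"
    by (simp add: int_norm_def B_def C_def)
  finally show ?thesis by (rule that)
qed

section \<open>The lattice behind a two-dimensional projection\<close>

text \<open>The subgroup of \<open>\<int>\<^sup>2\<close> generated by \<open>(a, b)\<close> and \<open>N \<int>\<^sup>2\<close>.\<close>

definition congruence_lattice :: "int \<Rightarrow> int \<Rightarrow> int \<Rightarrow> (int \<times> int) set" where
  "congruence_lattice N a b = {(x, y). \<exists>k. N dvd x - k * a \<and> N dvd y - k * b}"

lemma congruence_lattice_add:
  assumes "x \<in> congruence_lattice N a b" "y \<in> congruence_lattice N a b"
  shows "x + y \<in> congruence_lattice N a b"
proof -
  obtain x1 x2 y1 y2 where xy: "x = (x1, x2)" "y = (y1, y2)" by (cases x; cases y)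
  obtain k l where kl: "N dvd x1 - k * a" "N dvd x2 - k * b" "N dvd y1 - l * a" "N dvd y2 - l * b"
    using assms by (auto simp: congruence_lattice_def xy)
  have "N dvd (x1 + y1) - (k + l) * a" "N dvd (x2 + y2) - (k + l) * b"
    using dvd_add[OF kl(1,3)] dvd_add[OF kl(2,4)] by (simp_all add: algebra_simps)
  then show ?thesis by (auto simp: congruence_lattice_def xy)
qed

lemma congruence_lattice_scale:
  assumes "x \<in> congruence_lattice N a b"
  shows "(k * fst x, k * snd x) \<in> congruence_lattice N a b"
proof -
  obtain x1 x2 where x: "x = (x1, x2)" by (cases x)
  obtain l where "N dvd x1 - l * a" "N dvd x2 - l * b"
    using assms by (auto simp: congruence_lattice_def x)
  then have "N dvd k * (x1 - l * a)" "N dvd k * (x2 - l * b)" by simp_all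
  then have "N dvd k * x1 - (k * l) * a" "N dvd k * x2 - (k * l) * b"
    by (simp_all add: algebra_simps)
  then show ?thesis by (auto simp: congruence_lattice_def x)
qed

lemma congruence_lattice_diff:
  assumes "x \<in> congruence_lattice N a b" "y \<in> congruence_lattice N a b"
  shows "x - y \<in> congruence_lattice N a b"
proof -
  have "x - y = x + ((-1) * fst y, (-1) * snd y)" by (rule prod_eqI) simp_all
  then show ?thesis
    using congruence_lattice_add[OF assms(1) congruence_lattice_scale[OF assms(2), of "-1"]] by metis
qed

lemma congruence_lattice_multiples: "(N * i, N * j) \<in> congruence_lattice N a b"
  by (auto simp: congruence_lattice_def intro!: exI[of _ 0])

text \<open>Together with \<open>(0, N)\<close> such a vector has determinant \<open>N\<close>, which starts the reduction.\<close>

lemma congruence_lattice_unit_first: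
  assumes "coprime a N"
  obtains w where "(1, w) \<in> congruence_lattice N a b"
proof -
  obtain k l where kl: "k * a + l * N = 1"
    using assms bezout_int[of a N] by (auto simp: coprime_iff_gcd_eq_1)
  then have "1 - k * a = N * l" by (simp add: algebra_simps)
  then have "(1, k * b) \<in> congruence_lattice N a b"
    by (auto simp: congruence_lattice_def intro!: exI[of _ k])
  then show ?thesis by (rule that)
qed

definition projected_lattice :: "nat \<Rightarrow> int \<Rightarrow> int \<Rightarrow> nat \<Rightarrow> real \<times> real" where
  "projected_lattice N a b n = (frac (of_int (int n * a) / of_nat N), frac (of_int (int n * b) / of_nat N))"

text \<open>This is why the points of the family see only the residues of the lattice vectors modulo \<open>N\<close>.\<close>

lemma frac_div_shift:
  assumes "N > 0" "int N dvd x - y"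
  shows "frac (of_int x / real N) = frac (of_int y / real N)"
proof -
  obtain k where "x - y = int N * k" using assms(2) by auto
  then have "x = y + int N * k" by simp
  then have "of_int x / real N = of_int y / real N + of_int k"
    using assms(1) by (simp add: add_divide_distrib)
  then show ?thesis by (simp add: frac_def)
qed

lemma projected_lattice_hits:
  assumes N: "N > 0" and x: "x \<in> congruence_lattice (int N) a b"
    and box: "0 \<le> fst x" "fst x < int N" "0 \<le> snd x" "snd x < int N"
  obtains n where "n < N" "projected_lattice N a b n = (of_int (fst x) / real N, of_int (snd x) / real N)"
proof -
  obtain k where k: "int N dvd fst x - k * a" "int N dvd snd x - k * b"
    using x by (cases x) (auto simp: congruence_lattice_def)
  define n where "n = nat (k mod int N)"
  have n: "int n = k mod int N" "n < N" using N by (auto simp: n_def nat_less_iff)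
  have nk: "int N dvd int n - k" unfolding n by (metis mod_mod_trivial mod_eq_dvd_iff)
  have small: "frac (of_int y / real N) = of_int y / real N" if "0 \<le> y" "y < int N" for y
    using that N by (subst frac_eq) (auto simp: divide_simps)
  have shift: "frac (of_int (int n * c) / real N) = of_int y / real N"
    if "int N dvd y - k * c" "0 \<le> y" "y < int N" for c y
  proof -
    have "int n * c - y = (int n - k) * c - (y - k * c)" by (simp add: algebra_simps)
    moreover have "int N dvd (int n - k) * c" using nk by simp
    ultimately have "int N dvd int n * c - y" using dvd_diff that(1) by metis
    then show ?thesis using frac_div_shift[OF N] small that by metis
  qed
  show ?thesis
    by (rule that[OF n(2)]) (use shift k box in \<open>auto simp: projected_lattice_def simp del: of_int_mult\<close>)
qed

text \<open>Two points with different labels differ by \<open>1 / N\<close> times a lattice vector. That vector is not zero,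
  because modulo \<open>N\<close> its first coordinate is a nonzero difference of labels times \<open>a\<close>, which is
  invertible.\<close>

lemma separation_radius_ge:
  fixes D :: real
  assumes N: "N \<ge> 2" and cop: "coprime a (int N)" and D: "D > 0"
    and short: "\<And>u v. (u, v) \<in> congruence_lattice (int N) a b \<Longrightarrow> (u, v) \<noteq> (0, 0) \<Longrightarrow>
        real N \<le> D * (real_of_int (max \<bar>u\<bar> \<bar>v\<bar>))\<^sup>2"
  shows "1 / (2 * sqrt D) / sqrt N \<le> separation_radius N (projected_lattice N a b)"
proof -
  let ?Y = "projected_lattice N a b"
  let ?S = "{norm (?Y k - ?Y n) | k n. k < n \<and> n < N}"
  have "?S \<subseteq> (\<lambda>(k, n). norm (?Y k - ?Y n)) ` ({..<N} \<times> {..<N})" by force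
  then have fin: "finite ?S" by (rule finite_subset) simp
  have "norm (?Y 0 - ?Y 1) \<in> ?S" using N by force
  then have ne: "?S \<noteq> {}" by blast
  have "1 / sqrt D / sqrt N \<le> s" if "s \<in> ?S" for s
  proof -
    obtain k n where s: "s = norm (?Y k - ?Y n)" and kn: "k < n" "n < N" using \<open>s \<in> ?S\<close> by blast
    \<comment> \<open>subtracting the integer parts turns the difference of fractional parts into a lattice vector\<close>
    define fl where "fl c i = \<lfloor>of_int (int i * c) / real N\<rfloor>" for c i
    define x where "x c = (int k - int n) * c - int N * (fl c k - fl c n)" for c
    have coord: "frac (of_int (int k * c) / real N) - frac (of_int (int n * c) / real N)
        = of_int (x c) / real N" for c
    proof -
      have "real_of_int (x c) / real N = (real k - real n) * c / real N - (fl c k - fl c n)"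
        using N by (simp add: x_def diff_divide_distrib)
      then show ?thesis by (simp add: frac_def fl_def diff_divide_distrib left_diff_distrib)
    qed
    have inL: "(x a, x b) \<in> congruence_lattice (int N) a b"
    proof -
      have "int N dvd x c - (int k - int n) * c" for c by (simp add: x_def)
      then show ?thesis unfolding congruence_lattice_def by blast
    qed
    have "x a \<noteq> 0"
    proof
      assume "x a = 0"
      then have "int N dvd (int k - int n) * a" by (simp add: x_def)
      then have "int N dvd int k - int n"
        using cop by (simp add: coprime_commute coprime_dvd_mult_left_iff)
      then have "int N \<le> \<bar>int k - int n\<bar>" using kn by (intro zdvd_imp_le) (simp_all add: dvd_diff_commute)
      then show False using kn by linarith
    qed
    then have "real N \<le> D * (real_of_int (max \<bar>x a\<bar> \<bar>x b\<bar>))\<^sup>2"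
      using short[OF inL] by simp
    then have "sqrt N \<le> sqrt (D * (real_of_int (max \<bar>x a\<bar> \<bar>x b\<bar>))\<^sup>2)"
      by (rule real_sqrt_le_mono)
    then have "sqrt N \<le> sqrt D * real_of_int (max \<bar>x a\<bar> \<bar>x b\<bar>)"
      by (simp add: real_sqrt_mult)
    then have "sqrt N / (sqrt D * N) \<le> sqrt D * real_of_int (max \<bar>x a\<bar> \<bar>x b\<bar>) / (sqrt D * N)"
      using D by (intro divide_right_mono) auto
    moreover have "sqrt N / (sqrt D * N) = (sqrt N / N) / sqrt D" by simp
    then have "sqrt N / (sqrt D * N) = 1 / sqrt D / sqrt N"
      by (simp add: sqrt_divide_self_eq inverse_eq_divide)
    ultimately have 1: "1 / sqrt D / sqrt N \<le> max \<bar>of_int (x a)\<bar> \<bar>of_int (x b)\<bar> / real N"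
      using D by (simp add: of_int_max)
    have "max \<bar>of_int (x a)\<bar> \<bar>of_int (x b)\<bar> / real N = max \<bar>of_int (x a) / real N\<bar> \<bar>of_int (x b) / real N\<bar>"
      using N by (auto simp: max_def divide_le_cancel)
    also have "\<dots> \<le> norm (of_int (x a) / real N, of_int (x b) / real N)"
      using norm_fst_le[of "of_int (x a) / real N" "of_int (x b) / real N"]
        norm_snd_le[of "of_int (x b) / real N" "of_int (x a) / real N"] by simp
    also have "\<dots> = s"
      unfolding s projected_lattice_def by (simp only: coord diff_Pair)
    finally show ?thesis using 1 by linarith
  qed
  then have "1 / sqrt D / sqrt N \<le> Min ?S" using fin ne by (intro Min.boundedI)
  then show ?thesis unfolding separation_radius_def by simp
qed

section \<open>Fill distance of the projected lattice\<close>

lemma eta_pos: "eta > 0" by (simp add: eta_def)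

lemma eta_sq: "eta\<^sup>2 = 2 / sqrt 3"
  by (simp add: eta_def powr_half_sqrt)

lemma eta_gt_1: "eta > 1"
proof -
  have "sqrt 3 < 2" by (rule real_less_lsqrt) auto
  then have "1 < eta\<^sup>2" by (simp add: eta_sq)
  then show ?thesis using eta_pos power_less_imp_less_base[of 1 2 eta] by simp
qed

text \<open>The upper bound for the product of the lengths of a reduced pair and the lower bound for
  the shorter vector together bound the longer one. The comparison of \<open>eta\<close> with the last constant
  expresses that the upper and lower bounds for the shorter vector are compatible.\<close>

lemma short_basis:
  fixes D :: real and N :: nat
  assumes N: "N > 0" and cop: "coprime a (int N)" and D: "D > 0"
    and short: "\<And>u v. (u, v) \<in> congruence_lattice (int N) a b \<Longrightarrow> (u, v) \<noteq> (0, 0) \<Longrightarrow>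
        real N \<le> D * (real_of_int (max \<bar>u\<bar> \<bar>v\<bar>))\<^sup>2"
  obtains c d where "c \<in> congruence_lattice (int N) a b" "d \<in> congruence_lattice (int N) a b"
    "det2 c d \<noteq> 0" "int_norm c \<le> eta * sqrt N" "int_norm d \<le> 2 * sqrt D / sqrt 3 * sqrt N"
    "eta \<le> 2 * sqrt D / sqrt 3"
proof -
  let ?L = "congruence_lattice (int N) a b"
  obtain w where w: "(1, w) \<in> ?L" using cop by (rule congruence_lattice_unit_first)
  have v: "(0, int N) \<in> ?L" using congruence_lattice_multiples[of "int N" 0 1] by simp
  obtain c d where cd: "c \<in> ?L" "d \<in> ?L" "\<bar>det2 c d\<bar> = \<bar>det2 (1, w) (0, int N)\<bar>"
    "dot2 c c \<le> dot2 d d" "2 * \<bar>dot2 c d\<bar> \<le> dot2 c c"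
    by (rule reduced_pair_exists[OF congruence_lattice_add congruence_lattice_diff w v])
  have detN: "\<bar>det2 c d\<bar> = int N" using cd(3) by (simp add: det2_def)
  have nonneg: "0 \<le> int_norm x" for x by (simp add: int_norm_def)
  have "3 * (dot2 c c * dot2 d d) \<le> 4 * (int N)\<^sup>2"
    using reduced_pair_product[OF cd(4,5)] detN by (metis power2_abs)
  then have "real_of_int (3 * (dot2 c c * dot2 d d)) \<le> real_of_int (4 * (int N)\<^sup>2)"
    by (simp only: of_int_le_iff)
  then have "(int_norm c * int_norm d)\<^sup>2 \<le> (2 / sqrt 3 * N)\<^sup>2"
    by (simp add: power_mult_distrib int_norm_sq power_divide)
  then have prod: "int_norm c * int_norm d \<le> 2 / sqrt 3 * N"
    by (rule power2_le_imp_le) simp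
  have "(int_norm c)\<^sup>2 \<le> (int_norm d)\<^sup>2" using cd(4) by (simp add: int_norm_sq)
  then have le: "int_norm c \<le> int_norm d" by (rule power2_le_imp_le) (rule nonneg)
  have "(int_norm c)\<^sup>2 \<le> int_norm c * int_norm d"
    unfolding power2_eq_square using le nonneg by (rule mult_left_mono)
  also have "\<dots> \<le> (eta * sqrt N)\<^sup>2"
    using prod by (simp add: power_mult_distrib eta_sq)
  finally have c_le: "int_norm c \<le> eta * sqrt N"
    by (rule power2_le_imp_le) (simp add: eta_pos less_imp_le)
  have "c \<noteq> (0, 0)" using detN N by (auto simp: det2_def)
  then have "real N \<le> D * (real_of_int (max \<bar>fst c\<bar> \<bar>snd c\<bar>))\<^sup>2"
    using short[of "fst c" "snd c"] cd(1) by (simp add: prod_eq_iff)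
  also have "\<dots> \<le> D * (int_norm c)\<^sup>2"
  proof (intro mult_left_mono power_mono)
    show "real_of_int (max \<bar>fst c\<bar> \<bar>snd c\<bar>) \<le> int_norm c"
      using norm_fst_le[of "real_of_int (fst c)" "real_of_int (snd c)"]
        norm_snd_le[of "real_of_int (snd c)" "real_of_int (fst c)"]
      by (simp add: int_norm_def of_int_max)
  qed (use D in auto)
  finally have "sqrt N \<le> sqrt (D * (int_norm c)\<^sup>2)" by (rule real_sqrt_le_mono)
  then have c_ge: "sqrt N \<le> sqrt D * int_norm c" using nonneg by (simp add: real_sqrt_mult)
  have "int_norm d * sqrt N \<le> int_norm d * (sqrt D * int_norm c)"
    using c_ge nonneg by (intro mult_left_mono)
  also have "\<dots> = sqrt D * (int_norm c * int_norm d)" by simp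
  also have "\<dots> \<le> sqrt D * (2 / sqrt 3 * N)" using prod D by (intro mult_left_mono) auto
  also have "\<dots> = (2 * sqrt D / sqrt 3 * sqrt N) * sqrt N" by simp
  finally have d_le: "int_norm d \<le> 2 * sqrt D / sqrt 3 * sqrt N"
    by (rule mult_right_le_imp_le) (use N in simp)
  have "sqrt N \<le> sqrt D * (eta * sqrt N)"
    by (rule order_trans[OF c_ge mult_left_mono[OF c_le]]) (use D in simp)
  then have "1 \<le> sqrt D * eta" using N by simp
  then have "eta * 1 \<le> eta * (sqrt D * eta)" using eta_pos by (intro mult_left_mono) auto
  also have "\<dots> = eta\<^sup>2 * sqrt D" by (simp add: power2_eq_square)
  also have "\<dots> = 2 * sqrt D / sqrt 3" by (simp add: eta_sq)
  finally have "eta \<le> 2 * sqrt D / sqrt 3" by simp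
  with cd c_le d_le detN N show ?thesis by (intro that[of c d]) auto
qed

lemma norm_pair_le: "norm (x :: real, y :: real) \<le> s" if "x\<^sup>2 + y\<^sup>2 \<le> s\<^sup>2" "0 \<le> s"
  using that by (simp add: norm_Pair real_le_lsqrt)

lemma clamp_close:
  fixes r x :: real
  assumes "0 < r" "r < 1/2" "0 \<le> x" "x < 1"
  obtains x' where "r \<le> x'" "x' \<le> 1 - r" "\<bar>x - x'\<bar> \<le> r"
proof
  show "r \<le> max r (min x (1 - r))" "max r (min x (1 - r)) \<le> 1 - r"
    "\<bar>x - max r (min x (1 - r))\<bar> \<le> r"
    using assms by (auto simp: max_def min_def)
qed

text \<open>A disc of radius \<open>r\<close> centred in \<open>[r, 1 - r]\<^sup>2\<close> stays in the unit square, so a lattice point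
  found strictly inside it is one of the projected points. Moving an arbitrary point of the square to
  such a centre costs at most \<open>r\<close> in each coordinate.\<close>

lemma near_point_interior:
  fixes r x y :: real
  assumes N: "N > 0"
    and cd: "c \<in> congruence_lattice (int N) a b" "d \<in> congruence_lattice (int N) a b"
      "det2 c d \<noteq> 0" "(int_norm c + int_norm d) / 2 < r * N"
    and r: "r < 1 / 2"
    and xy: "0 \<le> x" "x < 1" "0 \<le> y" "y < 1"
  obtains n where "n < N" "norm ((x, y) - projected_lattice N a b n) \<le> (1 + sqrt 2) * r"
proof -
  have "0 \<le> (int_norm c + int_norm d) / 2" by (simp add: int_norm_def)
  then have rpos: "0 < r" using cd(4) N by (smt (verit) mult_nonpos_nonneg of_nat_0_le_iff)
  obtain x' where x': "r \<le> x'" "x' \<le> 1 - r" "\<bar>x - x'\<bar> \<le> r"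
    using clamp_close[OF rpos r xy(1,2)] by blast
  obtain y' where y': "r \<le> y'" "y' \<le> 1 - r" "\<bar>y - y'\<bar> \<le> r"
    using clamp_close[OF rpos r xy(3,4)] by blast
  obtain k l :: int where kl: "norm ((N * x', N * y') - (of_int (k * fst c + l * fst d), of_int (k * snd c + l * snd d)))
       \<le> (int_norm c + int_norm d) / 2"
    using close_lattice_point[OF cd(3)] by blast
  define u where "u = k * fst c + l * fst d"
  define v where "v = k * snd c + l * snd d"
  have uv: "(u, v) \<in> congruence_lattice (int N) a b"
    using congruence_lattice_add[OF congruence_lattice_scale[OF cd(1), of k] congruence_lattice_scale[OF cd(2), of l]]
    by (simp add: u_def v_def)
  have close: "norm (N * x' - u, N * y' - v) < r * N"
    using kl cd(4) by (simp add: u_def v_def)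
  have "\<bar>N * x' - u\<bar> < r * N" "\<bar>N * y' - v\<bar> < r * N"
    using norm_fst_le[of "N * x' - u" "N * y' - v"] norm_snd_le[of "N * y' - v" "N * x' - u"] close
    by auto
  moreover have "r * N \<le> N * x'" "r * N \<le> N * y'" "N * x' \<le> N - r * N" "N * y' \<le> N - r * N"
  proof -
    have "real N * r \<le> real N * x'" "real N * r \<le> real N * y'"
      "real N * x' \<le> real N * (1 - r)" "real N * y' \<le> real N * (1 - r)"
      using x' y' by (auto intro!: mult_left_mono)
    then show "r * N \<le> N * x'" "r * N \<le> N * y'" "N * x' \<le> N - r * N" "N * y' \<le> N - r * N"
      by (simp_all add: algebra_simps)
  qed
  ultimately have "0 < real_of_int u" "real_of_int u < N" "0 < real_of_int v" "real_of_int v < N"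
    by linarith+
  then have "0 \<le> u" "u < int N" "0 \<le> v" "v < int N" by linarith+
  then obtain n where n: "n < N" "projected_lattice N a b n = (of_int u / real N, of_int v / real N)"
    using projected_lattice_hits[OF N uv] by auto
  have "(x', y') - projected_lattice N a b n = (1 / real N) *\<^sub>R (N * x' - u, N * y' - v)"
    using N by (simp add: n diff_divide_distrib)
  then have "norm ((x', y') - projected_lattice N a b n) = (1 / real N) * norm (N * x' - u, N * y' - v)"
    by (metis norm_scaleR abs_of_nonneg of_nat_0_le_iff zero_le_divide_1_iff)
  also have "\<dots> \<le> (1 / real N) * (r * N)" using close by (intro mult_left_mono) auto
  also have "\<dots> = r" using N by simp
  finally have 1: "norm ((x', y') - projected_lattice N a b n) \<le> r" .
  have 2: "norm ((x, y) - (x', y')) \<le> sqrt 2 * r"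
  proof -
    have "(x - x')\<^sup>2 \<le> r\<^sup>2" "(y - y')\<^sup>2 \<le> r\<^sup>2"
      using x'(3) y'(3) by (metis abs_ge_zero power2_abs power_mono)+
    then show ?thesis using rpos by (auto intro!: norm_pair_le simp: power_mult_distrib)
  qed
  have "norm ((x, y) - projected_lattice N a b n)
      \<le> norm ((x, y) - (x', y')) + norm ((x', y') - projected_lattice N a b n)"
    using norm_triangle_ineq[of "(x, y) - (x', y')" "(x', y') - projected_lattice N a b n"]
    by (simp only: diff_add_cancel add_diff_eq)
  also have "\<dots> \<le> (1 + sqrt 2) * r" using 1 2 by (simp add: algebra_simps)
  finally show ?thesis using that n(1) by blast
qed

text \<open>The origin serves the left half of the square. As \<open>a\<close> is invertible modulo \<open>N\<close>, some point has first
  coordinate \<open>(N - 1) / N \<ge> 1/2\<close> and serves the right half. In both cases the distance is at most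
  \<open>\<surd>5 / 2 \<le> (1 + \<surd>2) / 2\<close>; the diameter \<open>\<surd>2\<close> of the square would be too large.\<close>

lemma near_point_trivial:
  fixes x y :: real
  assumes N: "N \<ge> 2" and cop: "coprime a (int N)"
    and xy: "0 \<le> x" "x < 1" "0 \<le> y" "y < 1"
  obtains n where "n < N" "norm ((x, y) - projected_lattice N a b n) \<le> (1 + sqrt 2) / 2"
proof -
  have N0: "N > 0" using N by simp
  have small: "norm (s, t) \<le> (1 + sqrt 2) / 2" if "\<bar>s\<bar> \<le> 1 / 2" "\<bar>t\<bar> \<le> 1" for s t :: real
  proof (rule norm_pair_le)
    have "s\<^sup>2 \<le> (1 / 2)\<^sup>2" "t\<^sup>2 \<le> 1\<^sup>2"
      using that by (metis abs_ge_zero power2_abs power_mono)+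
    then have "s\<^sup>2 \<le> 1 / 4" "t\<^sup>2 \<le> 1" by (simp_all add: power_divide)
    moreover have "1 \<le> sqrt 2" by simp
    ultimately have "s\<^sup>2 * 4 + t\<^sup>2 * 4 \<le> 3 + 2 * sqrt 2" by linarith
    then show "s\<^sup>2 + t\<^sup>2 \<le> ((1 + sqrt 2) / 2)\<^sup>2"
      by (simp add: power_divide power2_sum)
  qed simp
  show ?thesis
  proof (cases "x < 1 / 2")
    case True
    have "projected_lattice N a b 0 = (0, 0)" by (simp add: projected_lattice_def)
    then have "norm ((x, y) - projected_lattice N a b 0) \<le> (1 + sqrt 2) / 2"
      using small[of x y] True xy by simp
    then show ?thesis using that N0 by blast
  next
    case False
    obtain w where w: "(1, w) \<in> congruence_lattice (int N) a b"
      using cop by (rule congruence_lattice_unit_first)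
    define v where "v = (- w) mod int N"
    \<comment> \<open>\<open>- (1, w)\<close>, moved into the fundamental square by a multiple of \<open>N\<close> in each coordinate\<close>
    have "v = - w - int N * ((- w) div int N)"
      using minus_mod_eq_mult_div[of "- w" "int N"] unfolding v_def by linarith
    then have "(int N - 1, v) = (int N * 1, int N * (- ((- w) div int N))) - (1, w)"
      by simp
    then have "(int N - 1, v) \<in> congruence_lattice (int N) a b"
      using congruence_lattice_diff[OF congruence_lattice_multiples w] by metis
    moreover have v: "0 \<le> v" "v < int N" using N0 by (simp_all add: v_def)
    ultimately obtain n where n: "n < N"
        "projected_lattice N a b n = (of_int (int N - 1) / real N, of_int v / real N)"
      using projected_lattice_hits[OF N0, of "(int N - 1, v)"] N by auto
    have "1 / 2 \<le> of_int (int N - 1) / real N" "of_int (int N - 1) / real N \<le> 1"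
      "0 \<le> of_int v / real N" "of_int v / real N \<le> 1"
      using N v by (simp_all add: field_simps)
    then have "norm ((x, y) - projected_lattice N a b n) \<le> (1 + sqrt 2) / 2"
      using small[of "x - of_int (int N - 1) / real N" "y - of_int v / real N"] False xy
      unfolding n diff_Pair by linarith
    then show ?thesis using that n(1) by blast
  qed
qed

lemma fill_distance_le:
  assumes N: "N > 0"
    and near: "\<And>x y. 0 \<le> x \<Longrightarrow> x < 1 \<Longrightarrow> 0 \<le> y \<Longrightarrow> y < 1 \<Longrightarrow>
      \<exists>n<N. norm ((x, y) - Y n) \<le> h"
  shows "fill_distance N (Y :: nat \<Rightarrow> real \<times> real) \<le> h"
  unfolding fill_distance_def
proof (rule cSUP_least)
  have "(0, 0) \<in> (half_open_cube :: (real \<times> real) set)"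
    by (auto simp: half_open_cube_def Basis_prod_def)
  then show "(half_open_cube :: (real \<times> real) set) \<noteq> {}" by blast
next
  fix z :: "real \<times> real" assume "z \<in> half_open_cube"
  moreover obtain x y where z: "z = (x, y)" by (cases z)
  ultimately have "0 \<le> x" "x < 1" "0 \<le> y" "y < 1"
    by (auto simp: half_open_cube_def Basis_prod_def)
  from near[OF this] obtain n where "n < N" "norm (z - Y n) \<le> h" unfolding z by blast
  then show "Min ((\<lambda>n. norm (z - Y n)) ` {..<N}) \<le> h"
    by (intro Min.coboundedI[THEN order_trans]) auto
qed

text \<open>Write \<open>R\<close> for half the sum of the two bounds of \<open>short_basis\<close>, divided by \<open>N\<close>. A lattice point at
  distance exactly \<open>R\<close> from the moved target could lie on the excluded right or upper edge, so the
  estimate is proved for every radius \<open>r\<close> above \<open>R\<close> and the limit is taken. Radii from \<open>1/2\<close> on are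
  covered by \<open>near_point_trivial\<close>.\<close>

lemma fill_distance_lattice_le:
  fixes D :: real and N :: nat
  assumes N: "N \<ge> 2" and cop: "coprime a (int N)" and D: "D > 0"
    and short: "\<And>u v. (u, v) \<in> congruence_lattice (int N) a b \<Longrightarrow> (u, v) \<noteq> (0, 0) \<Longrightarrow>
        real N \<le> D * (real_of_int (max \<bar>u\<bar> \<bar>v\<bar>))\<^sup>2"
  defines "A \<equiv> 2 * sqrt D / sqrt 3"
  shows "fill_distance N (projected_lattice N a b) \<le> (1 + sqrt 2) * ((eta + A) / 2 / sqrt N)"
    and "eta \<le> A"
proof -
  have N0: "N > 0" using N by simp
  obtain c d where cd: "c \<in> congruence_lattice (int N) a b" "d \<in> congruence_lattice (int N) a b"
    "det2 c d \<noteq> 0" "int_norm c \<le> eta * sqrt N" "int_norm d \<le> A * sqrt N" and etaA: "eta \<le> A"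
    using short_basis[OF N0 cop D short] unfolding A_def by blast
  show "eta \<le> A" by (fact etaA)
  define R where "R = (eta + A) / 2 / sqrt N"
  have "fill_distance N (projected_lattice N a b) \<le> (1 + sqrt 2) * R"
  proof (rule field_le_epsilon)
    fix e :: real assume e: "0 < e"
    \<comment> \<open>chosen so that \<open>(1 + \<surd>2) r\<close> exceeds \<open>(1 + \<surd>2) R\<close> by exactly \<open>e\<close>\<close>
    define r where "r = R + e / (1 + sqrt 2)"
    have pos: "0 < 1 + sqrt 2" by (simp add: add_pos_nonneg)
    have r: "R < r" "(1 + sqrt 2) * r = (1 + sqrt 2) * R + e"
      using e pos by (simp_all add: r_def distrib_left)
    have "(int_norm c + int_norm d) / 2 \<le> (eta + A) / 2 * sqrt N"
      using cd(4,5) by (simp add: algebra_simps)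
    also have "\<dots> = R * N"
    proof -
      have "R * N = (eta + A) / 2 * (N / sqrt N)" by (simp add: R_def)
      then show ?thesis by (simp add: real_div_sqrt)
    qed
    also have "\<dots> < r * N" using r(1) N0 by simp
    finally have cover: "(int_norm c + int_norm d) / 2 < r * N" .
    have "fill_distance N (projected_lattice N a b) \<le> (1 + sqrt 2) * r"
    proof (rule fill_distance_le[OF N0])
      fix x y :: real assume xy: "0 \<le> x" "x < 1" "0 \<le> y" "y < 1"
      show "\<exists>n<N. norm ((x, y) - projected_lattice N a b n) \<le> (1 + sqrt 2) * r"
      proof (cases "r < 1 / 2")
        case True
        then show ?thesis using near_point_interior[OF N0 cd(1-3) cover True xy] by blast
      next
        case False
        obtain n where n: "n < N" "norm ((x, y) - projected_lattice N a b n) \<le> (1 + sqrt 2) / 2"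
          using near_point_trivial[OF N cop xy] by blast
        have "(1 + sqrt 2) * (1 / 2) \<le> (1 + sqrt 2) * r"
          using False pos by (intro mult_left_mono) auto
        then show ?thesis using n by (intro exI[of _ n]) auto
      qed
    qed
    then show "fill_distance N (projected_lattice N a b) \<le> (1 + sqrt 2) * R + e"
      using r(2) by simp
  qed
  then show "fill_distance N (projected_lattice N a b) \<le> (1 + sqrt 2) * ((eta + A) / 2 / sqrt N)"
    by (simp add: R_def)
qed

section \<open>The generator of a real quadratic field\<close>

lemma type_ring_simps [simp]:
  "carrier type_ring = UNIV" "x \<oplus>\<^bsub>type_ring\<^esub> y = x + y" "x \<otimes>\<^bsub>type_ring\<^esub> y = x * y"
  "\<one>\<^bsub>type_ring\<^esub> = 1" "\<zero>\<^bsub>type_ring\<^esub> = 0"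
  by (simp_all add: ring_of_type_algebra_def)

lemma type_ring_minus [simp]: "\<ominus>\<^bsub>type_ring\<^esub> (x :: 'l::field_char_0) = - x"
proof -
  interpret cring "type_ring :: 'l ring" by (rule cring_from_type_algebra)
  show ?thesis
    by (rule minus_equality) simp_all
qed

lemma type_ring_inv [simp]: "inv\<^bsub>type_ring\<^esub> (x :: 'l::field_char_0) = inverse x" if "x \<noteq> 0"
proof -
  interpret field "type_ring :: 'l ring" by (rule field_from_type_algebra)
  show ?thesis
    by (rule comm_inv_char) (use that in simp_all)
qed

lemma ring_of_integers_simps [simp]:
  "carrier ring_of_integers = {x. algebraic_int x}"
  "x \<oplus>\<^bsub>ring_of_integers\<^esub> y = x + y" "x \<otimes>\<^bsub>ring_of_integers\<^esub> y = x * y"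
  "\<one>\<^bsub>ring_of_integers\<^esub> = 1" "\<zero>\<^bsub>ring_of_integers\<^esub> = 0"
  by (simp_all add: ring_of_integers_def)

text \<open>Homomorphisms of the record-based ring are ordinary field homomorphisms, hence fix the
  rationals.\<close>

lemma type_ring_hom_simps:
  fixes f :: "'a::field_char_0 \<Rightarrow> 'b::field_char_0"
  assumes "f \<in> ring_hom type_ring type_ring"
  shows "f (x + y) = f x + f y" "f (x * y) = f x * f y" "f 1 = 1" "f 0 = 0" "f (- x) = - f x"
    "f (x - y) = f x - f y" "f (inverse x) = inverse (f x)" "f (of_int k) = of_int k"
    "f (of_rat q) = of_rat q"
proof -
  show add: "f (x + y) = f x + f y" for x y
    using ring_hom_add[OF assms, of x y] by simp
  show mult: "f (x * y) = f x * f y" for x y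
    using ring_hom_mult[OF assms, of x y] by simp
  show one: "f 1 = 1" using ring_hom_one[OF assms] by simp
  show zero: "f 0 = 0" using add[of 0 0] by simp
  show minus: "f (- x) = - f x" for x
    using add[of x "- x"] zero by (simp add: add_eq_0_iff)
  show "f (x - y) = f x - f y" using add[of x "- y"] minus[of y] by simp
  show inv: "f (inverse x) = inverse (f x)" for x
  proof (cases "x = 0")
    case False
    then have "f x * f (inverse x) = 1" using mult[of x "inverse x"] one by simp
    then show ?thesis by (metis inverse_unique)
  qed (simp add: zero)
  have nat: "f (of_nat n) = of_nat n" for n
    by (induction n) (simp_all add: zero one add)
  show int: "f (of_int k) = of_int k" for k
    by (cases k rule: int_cases2) (simp_all add: nat minus)
  show "f (of_rat q) = of_rat q"
  proof (cases q)
    case (Fract a b)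
    then have "of_rat q = (of_int a * inverse (of_int b) :: 'a)"
      "of_rat q = (of_int a * inverse (of_int b) :: 'b)"
      by (simp_all add: of_rat_rat divide_inverse)
    then show ?thesis by (simp add: mult int inv)
  qed
qed

lemma type_ring_hom_eqI:
  fixes f g :: "'a::field_char_0 \<Rightarrow> 'b::field_char_0"
  assumes gen: "generate_field type_ring {\<omega>} = UNIV"
    and f: "f \<in> ring_hom type_ring type_ring" and g: "g \<in> ring_hom type_ring type_ring"
    and eq: "f \<omega> = g \<omega>"
  shows "f = g"
proof
  fix x
  have "x \<in> generate_field type_ring {\<omega>}" using gen by simp
  then show "f x = g x"
    by induction (use eq in \<open>auto simp: type_ring_hom_simps[OF f] type_ring_hom_simps[OF g]\<close>)
qed

lemma type_ring_hom_eq_0_iff: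
  assumes "f \<in> ring_hom type_ring type_ring"
  shows "f x = 0 \<longleftrightarrow> x = 0"
proof
  assume fx: "f x = 0"
  show "x = 0"
  proof (rule ccontr)
    assume "x \<noteq> 0"
    then show False
      using type_ring_hom_simps(2)[OF assms, of x "inverse x"] type_ring_hom_simps(3)[OF assms] fx
      by simp
  qed
qed (simp add: type_ring_hom_simps[OF assms])

lemma algebraic_int_hom:
  assumes f: "f \<in> ring_hom type_ring type_ring" and "algebraic_int x"
  shows "algebraic_int (f x)"
proof -
  obtain p where p: "poly (map_poly of_int p) x = 0" "Polynomial.lead_coeff p = 1"
    using assms(2) algebraic_int_altdef_ipoly by blast
  have "f (poly (map_poly of_int q) x) = poly (map_poly of_int q) (f x)" for q
    by (induction q) (simp_all add: map_poly_pCons type_ring_hom_simps[OF f])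
  then have "poly (map_poly of_int p) (f x) = 0" using p by (metis type_ring_hom_simps(4)[OF f])
  then show ?thesis using p(2) algebraic_int_altdef_ipoly by blast
qed

text \<open>In dimension two, \<open>\<omega>\<^sup>2\<close> depends linearly on the independent elements \<open>1\<close> and \<open>\<omega>\<close>.\<close>

lemma generator_relation_over_rat:
  fixes \<omega> :: "'l::field_char_0"
  assumes dim: "vector_space.dim (\<lambda>(q::rat) (x::'l). of_rat q * x) UNIV = 2"
    and irr: "\<And>q. \<omega> \<noteq> of_rat q"
  obtains r s :: rat where "\<omega> * \<omega> = of_rat r * \<omega> + of_rat s"
proof -
  interpret vs: vector_space "\<lambda>(q::rat) (x::'l). of_rat q * x"
    by unfold_locales (simp_all add: algebra_simps of_rat_add of_rat_mult)
  obtain B where B: "vs.independent B" "UNIV \<subseteq> vs.span B" "card B = 2"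
    using vs.basis_exists[of UNIV] dim by metis
  have finB: "finite B" using B(3) by (metis card.infinite zero_neq_numeral)
  have spans: "vs.span {1} = {of_rat q | q. True}"
    by (auto simp: vs.span_singleton)
  have ind: "vs.independent {\<omega>, 1}"
    using irr by (intro vs.independent_insertI) (auto simp: spans vs.independent_empty)
  have "\<omega> \<noteq> 1" using irr[of 1] by simp
  have "\<omega> * \<omega> \<in> vs.span {\<omega>, 1}"
  proof (rule ccontr)
    assume out: "\<omega> * \<omega> \<notin> vs.span {\<omega>, 1}"
    then have "vs.independent {\<omega> * \<omega>, \<omega>, 1}" using ind by (rule vs.independent_insertI)
    then have "card {\<omega> * \<omega>, \<omega>, 1} \<le> 2"
      using vs.independent_span_bound[OF finB] B by (metis subset_UNIV subset_trans)
    moreover have "\<omega> * \<omega> \<notin> {\<omega>, 1}" using out vs.span_base by metis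
    ultimately show False using \<open>\<omega> \<noteq> 1\<close> by simp
  qed
  then obtain r where "\<omega> * \<omega> - of_rat r * \<omega> \<in> vs.span {1}"
    using vs.span_breakdown_eq by blast
  then obtain s where "\<omega> * \<omega> - of_rat r * \<omega> = of_rat s" using spans by auto
  then have "\<omega> * \<omega> = of_rat r * \<omega> + of_rat s" by (simp add: algebra_simps)
  then show ?thesis by (rule that)
qed

text \<open>A field homomorphism preserves the relation \<open>\<omega>\<^sup>2 = r \<omega> + s\<close> and is determined by its value at
  \<open>\<omega>\<close>. So \<open>\<sigma> 1 \<omega>\<close> and \<open>\<sigma> 2 \<omega>\<close> are the two roots in the reals, and \<open>\<omega>\<close> and \<open>\<tau> \<omega>\<close> the two roots in
  the field. The latter are algebraic integers, so their sum \<open>r\<close> and product \<open>- s\<close> are rational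
  algebraic integers, that is, integers.\<close>

lemma generator_relation_over_int:
  fixes \<omega> :: "'l::field_char_0" and \<sigma> :: "nat \<Rightarrow> 'l \<Rightarrow> real" and \<tau> :: "'l \<Rightarrow> 'l"
  assumes quadratic: "real_quadratic_field TYPE('l)"
    and L_gen: "generate_field type_ring {\<omega>} = (UNIV :: 'l set)"
    and OL_gen: "carrier (ring_of_integers :: 'l ring) = generate_ring type_ring {\<omega>}"
    and sigma: "bij_betw \<sigma> {1..2} real_embeddings"
    and conj: "nontrivial_automorphism \<tau>"
  obtains r s :: int where "\<omega> * \<omega> = of_int r * \<omega> + of_int s"
    "\<sigma> 1 \<omega> + \<sigma> 2 \<omega> = of_int r" "\<sigma> 1 \<omega> * \<sigma> 2 \<omega> = - of_int s"
    "\<And>q. \<omega> \<noteq> of_rat q"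
proof -
  have \<tau>: "\<tau> \<in> ring_hom type_ring type_ring" "\<tau> \<noteq> id"
    using conj by (auto simp: nontrivial_automorphism_def ring_iso_def)
  have idh: "id \<in> ring_hom type_ring type_ring" by (rule ring_hom_memI) auto
  have ne: "\<tau> \<omega> \<noteq> \<omega>" using type_ring_hom_eqI[OF L_gen \<tau>(1) idh] \<tau>(2) by auto
  then have irr: "\<omega> \<noteq> of_rat q" for q using type_ring_hom_simps(9)[OF \<tau>(1), of q] by auto
  obtain r s :: rat where rs: "\<omega> * \<omega> = of_rat r * \<omega> + of_rat s"
    using generator_relation_over_rat[OF _ irr] quadratic unfolding real_quadratic_field_def by blast
  have roots: "x + y = of_rat r \<and> x * y = - of_rat s"
    if "x * x = of_rat r * x + of_rat s" "y * y = of_rat r * y + of_rat s" "x \<noteq> y" for x y :: "'a::field_char_0"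
  proof -
    have "(x - y) * (x + y) = (x - y) * of_rat r" using that(1,2) by (simp add: algebra_simps)
    then have sum: "x + y = of_rat r" using that(3) by simp
    have "x * y = x * of_rat r - x * x" by (simp add: sum[symmetric] algebra_simps)
    then show ?thesis using sum that(1) by simp
  qed
  have hom_root: "f \<omega> * f \<omega> = of_rat r * f \<omega> + of_rat s"
    if f: "f \<in> ring_hom type_ring type_ring" for f :: "'l \<Rightarrow> 'a::field_char_0"
  proof -
    have "f (\<omega> * \<omega>) = f (of_rat r * \<omega> + of_rat s)" by (simp only: rs)
    then show ?thesis by (simp only: type_ring_hom_simps[OF f])
  qed
  have sig: "\<sigma> 1 \<in> ring_hom type_ring type_ring" "\<sigma> 2 \<in> ring_hom type_ring type_ring"
    using bij_betwE[OF sigma] by (auto simp: real_embeddings_def)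
  have "\<sigma> 1 \<noteq> \<sigma> 2" using inj_onD[OF bij_betw_imp_inj_on[OF sigma], of 1 2] by auto
  then have "\<sigma> 1 \<omega> \<noteq> \<sigma> 2 \<omega>" using type_ring_hom_eqI[OF L_gen sig(1,2)] by blast
  then have sigma_rs: "\<sigma> 1 \<omega> + \<sigma> 2 \<omega> = of_rat r" "\<sigma> 1 \<omega> * \<sigma> 2 \<omega> = - of_rat s"
    using roots[OF hom_root[OF sig(1)] hom_root[OF sig(2)]] by auto
  have tau_rs: "\<tau> \<omega> + \<omega> = of_rat r" "\<tau> \<omega> * \<omega> = - of_rat s"
    using roots[OF hom_root[OF \<tau>(1)] rs ne] by auto
  have om: "algebraic_int \<omega>"
    using OL_gen generate_ring.incl[of \<omega> "{\<omega>}" type_ring] by auto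
  have "\<tau> \<omega> \<in> generate_ring type_ring {\<omega>}" "\<omega> \<in> generate_ring type_ring {\<omega>}"
    using algebraic_int_hom[OF \<tau>(1) om] om OL_gen by auto
  then have "\<tau> \<omega> \<oplus>\<^bsub>type_ring\<^esub> \<omega> \<in> generate_ring type_ring {\<omega>}"
    "\<tau> \<omega> \<otimes>\<^bsub>type_ring\<^esub> \<omega> \<in> generate_ring type_ring {\<omega>}"
    by (auto intro: generate_ring.intros simp del: type_ring_simps)
  then have "of_rat r \<in> carrier (ring_of_integers :: 'l ring)"
    "- of_rat s \<in> carrier (ring_of_integers :: 'l ring)"
    unfolding OL_gen by (simp_all add: tau_rs)
  then have "algebraic_int (of_rat r :: 'l)" "algebraic_int (of_rat s :: 'l)" by simp_all
  then have ints: "(of_rat r :: 'l) \<in> \<int>" "(of_rat s :: 'l) \<in> \<int>"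
    by (auto intro!: rational_algebraic_int_is_int)
  obtain r' where r': "(of_rat r :: 'l) = of_int r'" using ints by (auto elim: Ints_cases)
  obtain s' where s': "(of_rat s :: 'l) = of_int s'" using ints by (auto elim: Ints_cases)
  have r: "r = of_int r'" using r' by (metis of_rat_eq_iff of_rat_of_int_eq)
  have s: "s = of_int s'" using s' by (metis of_rat_eq_iff of_rat_of_int_eq)
  show ?thesis
    by (rule that[of r' s']) (use rs sigma_rs irr in \<open>auto simp: r s\<close>)
qed

section \<open>The completed embedding into the p-adic integers\<close>

lemma (in cring) ideal_pow_simps:
  assumes "ideal I R"
  shows "ideal_pow R I (Suc m) = ideal_pow R I m \<cdot> I"
    "ideal (ideal_pow R I m) R" "ideal_pow R I (Suc 0) = I"
    "ideal_pow R I (Suc m) \<subseteq> ideal_pow R I m"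
proof -
  interpret S: comm_monoid "ideals_set R" by (rule ideals_set_is_comm_monoid)
  show Suc: "ideal_pow R I (Suc m) = ideal_pow R I m \<cdot> I" for m
    unfolding ideal_pow_def S.nat_pow_Suc by (simp add: ideals_set_def)
  have "I \<in> carrier (ideals_set R)" using assms by (simp add: ideals_set_def)
  then show id: "ideal (ideal_pow R I m) R" for m
    using S.nat_pow_closed[of I m] by (simp add: ideal_pow_def ideals_set_def)
  show "ideal_pow R I (Suc 0) = I"
    using S.nat_pow_eone[OF \<open>I \<in> carrier (ideals_set R)\<close>] by (simp add: ideal_pow_def)
  show "ideal_pow R I (Suc m) \<subseteq> ideal_pow R I m"
    using ideal_prod_inter[OF id assms] by (auto simp: Suc)
qed

text \<open>Componentwise this is the quotient map modulo a power of \<open>I\<close>.\<close>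

lemma (in cring) completion_map_hom:
  assumes "ideal I R"
  shows "completion_map R I \<in> ring_hom R (adic_completion R I)"
proof (rule ring_hom_memI)
  have hom: "(+>) (ideal_pow R I m) \<in> ring_hom R (R Quot (ideal_pow R I m))" for m
    using ideal.rcos_ring_hom[OF ideal_pow_simps(2)[OF assms]] .
  show "completion_map R I x \<in> carrier (adic_completion R I)" if "x \<in> carrier R" for x
    using ring_hom_closed[OF hom that] ideal_pow_simps(4)[OF assms]
    by (auto simp: adic_completion_def completion_map_def a_r_coset_def')
  fix x y assume xy: "x \<in> carrier R" "y \<in> carrier R"
  show "completion_map R I (x \<otimes> y) = completion_map R I x \<otimes>\<^bsub>adic_completion R I\<^esub> completion_map R I y"
    using ring_hom_mult[OF hom xy] by (simp add: adic_completion_def completion_map_def)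
  show "completion_map R I (x \<oplus> y) = completion_map R I x \<oplus>\<^bsub>adic_completion R I\<^esub> completion_map R I y"
    using ring_hom_add[OF hom xy] by (simp add: adic_completion_def completion_map_def)
next
  have hom: "(+>) (ideal_pow R I m) \<in> ring_hom R (R Quot (ideal_pow R I m))" for m
    using ideal.rcos_ring_hom[OF ideal_pow_simps(2)[OF assms]] .
  show "completion_map R I \<one> = \<one>\<^bsub>adic_completion R I\<^esub>"
    using ring_hom_one[OF hom] by (simp add: adic_completion_def completion_map_def)
qed

text \<open>An identification of the completion with another ring is injective only on the carrier, so it can be
  applied to a product of two elements only once that product is known to lie there.\<close>

lemma (in cring) adic_completion_mult_closed:
  assumes I: "ideal I R"
    and x: "x \<in> carrier (adic_completion R I)" and y: "y \<in> carrier (adic_completion R I)"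
  shows "x \<otimes>\<^bsub>adic_completion R I\<^esub> y \<in> carrier (adic_completion R I)"
proof -
  have "x m \<otimes>\<^bsub>R Quot (ideal_pow R I m)\<^esub> y m \<in> carrier (R Quot (ideal_pow R I m))" for m
  proof -
    interpret Q: ring "R Quot (ideal_pow R I m)"
      by (rule ideal.quotient_is_ring[OF ideal_pow_simps(2)[OF I]])
    show ?thesis using x y by (auto simp: adic_completion_def)
  qed
  moreover have "x (Suc m) \<otimes>\<^bsub>R Quot (ideal_pow R I (Suc m))\<^esub> y (Suc m)
      \<subseteq> x m \<otimes>\<^bsub>R Quot (ideal_pow R I m)\<^esub> y m" for m
  proof -
    have "x (Suc m) \<subseteq> x m" "y (Suc m) \<subseteq> y m" using x y by (auto simp: adic_completion_def)
    then show ?thesis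
      using ideal_pow_simps(4)[OF I, of m]
      by (auto simp: FactRing_def rcoset_mult_def a_r_coset_def') blast
  qed
  ultimately show ?thesis by (simp add: adic_completion_def)
qed

lemma padic_integers_simps:
  "x \<oplus>\<^bsub>padic_integers p\<^esub> y = (\<lambda>m. (x m + y m) mod int p ^ m)"
  "x \<otimes>\<^bsub>padic_integers p\<^esub> y = (\<lambda>m. (x m * y m) mod int p ^ m)"
  "\<one>\<^bsub>padic_integers p\<^esub> = (\<lambda>m. 1 mod int p ^ m)"
  "x \<in> carrier (padic_integers p) \<longleftrightarrow>
    (\<forall>m. x m \<in> {0..<int p ^ m} \<and> x (Suc m) mod int p ^ m = x m)"
  by (simp_all add: padic_integers_def)

lemma padic_embedding_hom:
  assumes "primeideal P ring_of_integers"
    and "\<phi> \<in> ring_iso (adic_completion ring_of_integers P) (padic_integers p)"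
  shows "padic_embedding P \<phi> \<in> ring_hom ring_of_integers (padic_integers p)"
proof -
  interpret primeideal P ring_of_integers by fact
  have "\<phi> \<circ> completion_map ring_of_integers P \<in> ring_hom ring_of_integers (padic_integers p)"
    using completion_map_hom[OF is_ideal] assms(2)
    by (auto simp: ring_iso_def intro: ring_hom_trans)
  then show ?thesis by (simp add: padic_embedding_def[abs_def] comp_def)
qed

lemma ring_of_integers_closed:
  assumes "cring (ring_of_integers :: 'l::field_char_0 ring)"
    and "algebraic_int (x :: 'l)" "algebraic_int (y :: 'l)"
  shows "algebraic_int (x + y)" "algebraic_int (x * y)"
proof -
  interpret cring "ring_of_integers :: 'l ring" by fact
  show "algebraic_int (x + y)" "algebraic_int (x * y)"
    using add.m_closed[of x y] m_closed[of x y] assms(2,3) by simp_all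
qed

lemma padic_hom_simps:
  fixes \<theta> :: "'l::field_char_0 \<Rightarrow> nat \<Rightarrow> int"
  assumes hom: "\<theta> \<in> ring_hom ring_of_integers (padic_integers p)"
  shows "algebraic_int x \<Longrightarrow> algebraic_int y \<Longrightarrow> \<theta> (x + y) m = (\<theta> x m + \<theta> y m) mod int p ^ m"
    and "algebraic_int x \<Longrightarrow> algebraic_int y \<Longrightarrow> \<theta> (x * y) m = (\<theta> x m * \<theta> y m) mod int p ^ m"
    and "\<theta> (of_int k) m = k mod int p ^ m"
    and "algebraic_int x \<Longrightarrow> 0 \<le> \<theta> x m \<and> \<theta> x m < int p ^ m"
    and "algebraic_int x \<Longrightarrow> \<theta> x (Suc m) mod int p ^ m = \<theta> x m"
proof -
  show add: "\<theta> (x + y) m = (\<theta> x m + \<theta> y m) mod int p ^ m"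
    if "algebraic_int x" "algebraic_int y" for x y
    using ring_hom_add[OF hom, of x y] that by (simp add: padic_integers_simps)
  show "algebraic_int x \<Longrightarrow> algebraic_int y \<Longrightarrow> \<theta> (x * y) m = (\<theta> x m * \<theta> y m) mod int p ^ m"
    using ring_hom_mult[OF hom, of x y] by (simp add: padic_integers_simps)
  have range: "0 \<le> \<theta> x m \<and> \<theta> x m < int p ^ m \<and> \<theta> x (Suc m) mod int p ^ m = \<theta> x m"
    if "algebraic_int x" for x m
    using ring_hom_closed[OF hom, of x] that by (simp add: padic_integers_simps)
  then show "algebraic_int x \<Longrightarrow> 0 \<le> \<theta> x m \<and> \<theta> x m < int p ^ m"
    "algebraic_int x \<Longrightarrow> \<theta> x (Suc m) mod int p ^ m = \<theta> x m"
    by (simp_all add: range)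
  have one: "\<theta> 1 m = 1 mod int p ^ m"
    using ring_hom_one[OF hom] by (simp add: padic_integers_simps)
  have red: "\<theta> x m mod int p ^ m = \<theta> x m" if "algebraic_int x" for x
    using range[OF that, of m] by (simp add: mod_pos_pos_trivial)
  have zero: "\<theta> 0 m = 0"
  proof -
    have "\<theta> 0 m = (\<theta> 0 m + \<theta> 0 m) mod int p ^ m" using add[of 0 0] by simp
    then have "(\<theta> 0 m + \<theta> 0 m) mod int p ^ m = \<theta> 0 m mod int p ^ m"
      using red[of 0] by simp
    then have "int p ^ m dvd \<theta> 0 m" by (metis add_diff_cancel_left' mod_eq_dvd_iff)
    then show ?thesis using red[of 0] by simp
  qed
  have nat: "\<theta> (of_nat n) m = int n mod int p ^ m" for n
  proof (induction n)
    case (Suc n)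
    then show ?case using add[of 1 "of_nat n"] one by (simp add: mod_simps)
  qed (simp add: zero)
  show "\<theta> (of_int k) m = k mod int p ^ m"
  proof (cases k rule: int_cases2)
    case (nonpos n)
    have "0 = (\<theta> (of_int k) m + int n) mod int p ^ m"
      using add[of "of_int k" "of_nat n"] nonpos zero nat[of n] by (simp add: mod_simps)
    then have "int p ^ m dvd \<theta> (of_int k) m - k" using nonpos by (simp add: mod_eq_0_iff_dvd)
    then show ?thesis using red[of "of_int k"] by (simp add: mod_eq_dvd_iff[symmetric])
  qed (simp add: nat)
qed

text \<open>The quotient is obtained by shifting: its residue modulo \<open>p\<^sup>m\<close> is determined by the residue of
  \<open>y\<close> modulo \<open>p\<^sup>m\<^sup>+\<^sup>1\<close>.\<close>

lemma padic_divisible_by_p: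
  assumes p: "p > 0" and y: "y \<in> carrier (padic_integers p)" and "y (Suc 0) = 0"
  obtains z where "z \<in> carrier (padic_integers p)"
    "\<And>m. y m = (int p * z m) mod int p ^ m"
proof -
  have y': "y m \<in> {0..<int p ^ m}" "y (Suc m) mod int p ^ m = y m" for m
    using y by (auto simp: padic_integers_simps)
  have p': "int p > 0" using p by simp
  have dvd: "int p dvd y (Suc m)" for m
  proof (induction m)
    case (Suc m)
    have "int p dvd y (Suc (Suc m)) mod int p ^ Suc m" using Suc y'(2)[of "Suc m"] by metis
    then show ?case by (simp add: dvd_mod_iff)
  qed (simp add: assms(3))
  define z where "z m = y (Suc m) div int p" for m
  have z: "y (Suc m) = int p * z m" for m using dvd[of m] by (simp add: z_def)
  have "z m \<in> {0..<int p ^ m}" for m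
    using y'(1)[of "Suc m"] p' by (auto simp: z zero_le_mult_iff)
  moreover have "z (Suc m) mod int p ^ m = z m" for m
  proof -
    have "int p * (z (Suc m) mod int p ^ m) = int p * z m"
      using y'(2)[of "Suc m"] by (simp add: z)
    then show ?thesis using p' by simp
  qed
  ultimately have "z \<in> carrier (padic_integers p)" by (simp add: padic_integers_simps)
  moreover have "y m = (int p * z m) mod int p ^ m" for m using y'(2)[of m] by (simp add: z)
  ultimately show ?thesis by (rule that)
qed

text \<open>A nonunit of \<open>\<int>\<^sub>p\<close> is \<open>p\<close> times some \<open>z\<close>. Pulling \<open>z\<close> back along the isomorphism \<open>\<phi>\<close> shows that
  \<open>x\<close> is divisible by \<open>p\<close> in the completion; its component modulo \<open>P\<close> is therefore zero, as \<open>p\<close> lies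
  in \<open>P\<close>.\<close>

lemma padic_embedding_nonunit:
  fixes P :: "'l::field_char_0 set"
  assumes P: "primeideal P ring_of_integers"
    and iso: "\<phi> \<in> ring_iso (adic_completion ring_of_integers P) (padic_integers p)"
    and p: "p > 0" "of_nat p \<in> P"
    and x: "algebraic_int x" "padic_embedding P \<phi> x (Suc 0) = 0"
  shows "x \<in> P"
proof -
  let ?OL = "ring_of_integers :: 'l ring"
  let ?c = "completion_map ?OL P"
  interpret primeideal P ?OL by fact
  interpret Q: ring "?OL Quot P" by (rule quotient_is_ring)
  note hom = padic_embedding_hom[OF P iso]
  note chom = completion_map_hom[OF is_ideal]
  have \<phi>: "\<phi> \<in> ring_hom (adic_completion ?OL P) (padic_integers p)"
    "bij_betw \<phi> (carrier (adic_completion ?OL P)) (carrier (padic_integers p))"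
    using iso by (auto simp: ring_iso_def)
  have "padic_embedding P \<phi> x \<in> carrier (padic_integers p)"
    using ring_hom_closed[OF hom, of x] x(1) by simp
  then obtain z where z: "z \<in> carrier (padic_integers p)"
    "\<And>m. padic_embedding P \<phi> x m = (int p * z m) mod int p ^ m"
    using padic_divisible_by_p[OF p(1)] x(2) by metis
  obtain w where w: "w \<in> carrier (adic_completion ?OL P)" "\<phi> w = z"
    using z(1) \<phi>(2) by (metis bij_betw_imp_surj_on imageE)
  let ?p = "of_nat p :: 'l"
  have pc: "?c ?p \<in> carrier (adic_completion ?OL P)" "?c x \<in> carrier (adic_completion ?OL P)"
    using ring_hom_closed[OF chom] x(1) by simp_all
  have "padic_embedding P \<phi> ?p m = int p mod int p ^ m" for m
    using padic_hom_simps(3)[OF hom, of "int p" m] by simp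
  then have "\<phi> (?c ?p \<otimes>\<^bsub>adic_completion ?OL P\<^esub> w) = \<phi> (?c x)"
    using ring_hom_mult[OF \<phi>(1) pc(1) w(1)] z(2)
    by (simp add: w(2) padic_integers_simps padic_embedding_def fun_eq_iff mod_simps)
  then have "?c ?p \<otimes>\<^bsub>adic_completion ?OL P\<^esub> w = ?c x"
    using \<phi>(2) adic_completion_mult_closed[OF is_ideal pc(1) w(1)] pc(2)
    by (metis bij_betw_imp_inj_on inj_onD)
  then have "(?c ?p \<otimes>\<^bsub>adic_completion ?OL P\<^esub> w) (Suc 0) = ?c x (Suc 0)" by simp
  then have "(P +>\<^bsub>?OL\<^esub> ?p) \<otimes>\<^bsub>?OL Quot P\<^esub> w (Suc 0) = P +>\<^bsub>?OL\<^esub> x"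
    by (simp add: adic_completion_def completion_map_def ideal_pow_simps(3)[OF is_ideal])
  moreover have "P +>\<^bsub>?OL\<^esub> ?p = \<zero>\<^bsub>?OL Quot P\<^esub>"
    using a_rcos_const[OF p(2)] by (simp add: FactRing_def)
  moreover have "w (Suc 0) \<in> carrier (?OL Quot P)"
  proof -
    have "w (Suc 0) \<in> carrier (?OL Quot (ideal_pow ?OL P (Suc 0)))"
      using w(1) unfolding adic_completion_def by fastforce
    then show ?thesis by (simp only: ideal_pow_simps(3)[OF is_ideal])
  qed
  ultimately have "P +>\<^bsub>?OL\<^esub> x = P" using Q.l_null by (simp add: FactRing_def)
  then show "x \<in> P" using a_rcos_self[of x] x(1) by simp
qed

section \<open>The norm bound for lattice vectors\<close>

lemma canonical_rep_props:
  assumes "v \<in> proj_line_rat"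
  shows "canonical_rep v = (a, b) \<Longrightarrow> v = proj_point (of_int a) (of_int b) \<and> (a, b) \<noteq> (0, 0)"
proof -
  assume "canonical_rep v = (a, b)"
  then have "is_canonical_rep v (a, b)"
    using theI'[OF ex1_canonical_rep[OF assms]] by (simp add: canonical_rep_def)
  then show ?thesis by (auto simp: is_canonical_rep_def)
qed

lemma proj_point_eq_if_proportional:
  fixes a b c d :: int
  assumes "a * d = b * c" "(a, b) \<noteq> (0, 0)" "(c, d) \<noteq> (0, 0)"
  shows "proj_point (of_int a) (of_int b) = proj_point (of_int c) (of_int d)"
proof -
  have cross: "of_int a * of_int d = (of_int b * of_int c :: rat)"
    using assms(1) by (metis of_int_mult)
  obtain t :: rat where t: "t \<noteq> 0" "of_int c = t * of_int a" "of_int d = t * of_int b"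
  proof (cases "a = 0")
    case True
    then have "b \<noteq> 0" "c = 0" "d \<noteq> 0" using assms by auto
    then show ?thesis using True by (intro that[of "of_int d / of_int b"]) auto
  next
    case False
    then have "c \<noteq> 0" using assms by auto
    then show ?thesis using False cross by (intro that[of "of_int c / of_int a"]) (auto simp: field_simps)
  qed
  have ab: "of_int a \<noteq> (0::rat) \<or> of_int b \<noteq> (0::rat)" using assms(2) by auto
  show ?thesis
    unfolding proj_point_def
  proof (intro Set.set_eqI)
    fix z :: "rat \<times> rat"
    obtain x y where z: "z = (x, y)" by (cases z)
    have "(\<exists>k. k \<noteq> 0 \<and> x = k * of_int a \<and> y = k * of_int b) \<longleftrightarrow>
        (\<exists>k. k \<noteq> 0 \<and> x = k * (t * of_int a) \<and> y = k * (t * of_int b))" (is "?l \<longleftrightarrow> ?r")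
    proof
      assume ?l
      then obtain k where "k \<noteq> 0" "x = k * of_int a" "y = k * of_int b" by blast
      then show ?r using t(1) by (intro exI[of _ "k / t"]) auto
    next
      assume ?r
      then obtain k where "k \<noteq> 0" "x = k * (t * of_int a)" "y = k * (t * of_int b)" by blast
      then show ?l using t(1) by (intro exI[of _ "k * t"]) auto
    qed
    then show "z \<in> proj_rel `` {(of_int a, of_int b)} \<longleftrightarrow> z \<in> proj_rel `` {(of_int c, of_int d)}"
      using ab t by (auto simp: proj_rel_def z)
  qed
qed

text \<open>Proportional coordinate pairs represent the same point of the projective line.\<close>

lemma configuration_independent:
  assumes V: "coeff_configuration V" and "i \<noteq> j"
    and i: "canonical_rep (V i) = (a, b)" and j: "canonical_rep (V j) = (c, d)"
  shows "a * d \<noteq> b * c"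
proof
  assume eq: "a * d = b * c"
  have mem: "V i \<in> proj_line_rat" "V j \<in> proj_line_rat" and inj: "inj V"
    using V by (auto simp: coeff_configuration_def)
  have "V i = V j"
    using canonical_rep_props[OF mem(1) i] canonical_rep_props[OF mem(2) j]
      proj_point_eq_if_proportional[OF eq] by metis
  then show False using inj \<open>i \<noteq> j\<close> by (auto dest: injD)
qed

text \<open>The element \<open>z = u y - v x\<close> lies in the kernel of \<open>\<theta>\<close> modulo \<open>p\<^sup>m\<close>, and so does its product with
  the conjugate \<open>z'\<close>, which is the rational integer \<open>e\<^sup>2 + r e g - s g\<^sup>2\<close> for \<open>z = e + g \<omega>\<close>. So \<open>p\<^sup>m\<close> divides
  the norm of \<open>z\<close>, which is nonzero because \<open>x\<close> and \<open>y\<close> are independent over the rationals.\<close>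

lemma short_vector_bound:
  fixes \<omega> :: "'l::field_char_0" and \<theta> :: "'l \<Rightarrow> nat \<Rightarrow> int"
    and \<sigma>1 \<sigma>2 :: "'l \<Rightarrow> real" and r s a b c d :: int
  assumes OL: "cring (ring_of_integers :: 'l ring)"
    and hom: "\<theta> \<in> ring_hom ring_of_integers (padic_integers p)"
    and sig: "\<sigma>1 \<in> ring_hom type_ring type_ring" "\<sigma>2 \<in> ring_hom type_ring type_ring"
    and \<omega>: "algebraic_int \<omega>" "\<omega> * \<omega> = of_int r * \<omega> + of_int s" "\<And>q. \<omega> \<noteq> of_rat q"
    and \<sigma>\<omega>: "\<sigma>1 \<omega> + \<sigma>2 \<omega> = of_int r" "\<sigma>1 \<omega> * \<sigma>2 \<omega> = - of_int s"
    and x: "x = of_int a + of_int b * \<omega>" and y: "y = of_int c + of_int d * \<omega>"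
    and indep: "a * d \<noteq> b * c"
    and uv: "(u, v) \<in> congruence_lattice (int (p ^ m)) (\<theta> x m) (\<theta> y m)" "(u, v) \<noteq> (0, 0)"
  shows "real (p ^ m) \<le> ((\<bar>\<sigma>1 x\<bar> + \<bar>\<sigma>1 y\<bar>) * (\<bar>\<sigma>2 x\<bar> + \<bar>\<sigma>2 y\<bar>)) * (real_of_int (max \<bar>u\<bar> \<bar>v\<bar>))\<^sup>2"
proof -
  note closed = ring_of_integers_closed[OF OL] int_imp_algebraic_int[OF Ints_of_int]
  note \<theta> = padic_hom_simps[OF hom]
  note s1 = type_ring_hom_simps[OF sig(1)] and s2 = type_ring_hom_simps[OF sig(2)]
  define q where "q = int p ^ m"
  define e where "e = u * c - v * a"
  define g where "g = u * d - v * b"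
  define z where "z = of_int e + of_int g * \<omega>"
  \<comment> \<open>the Galois conjugate of \<open>z\<close>, written with the trace \<open>r\<close> of \<open>\<omega>\<close>\<close>
  define z' where "z' = of_int (e + r * g) + of_int (- g) * \<omega>"
  have z_uv: "z = of_int u * y + of_int (- v) * x"
    by (simp add: z_def e_def g_def x y algebra_simps)
  have alg: "algebraic_int x" "algebraic_int y" "algebraic_int z" "algebraic_int z'"
    using \<omega>(1) unfolding x y z_def z'_def by (intro closed; simp add: closed)+
  have zz': "z * z' = of_int (e * e + r * e * g - s * g * g)"
  proof -
    have "z * z' = of_int (e * e + r * e * g) + of_int (r * g * g) * \<omega> - of_int (g * g) * (\<omega> * \<omega>)"
      by (simp add: z_def z'_def algebra_simps)
    then show ?thesis by (simp add: \<omega>(2) algebra_simps)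
  qed
  have sz: "\<sigma>1 z * \<sigma>2 z = of_int (e * e + r * e * g - s * g * g)"
  proof -
    have "\<sigma>1 z * \<sigma>2 z = of_int (e * e) + of_int (e * g) * (\<sigma>1 \<omega> + \<sigma>2 \<omega>) + of_int (g * g) * (\<sigma>1 \<omega> * \<sigma>2 \<omega>)"
      by (simp add: z_def s1 s2 algebra_simps)
    then show ?thesis by (simp add: \<sigma>\<omega> algebra_simps)
  qed
  have "q dvd \<theta> z m"
  proof -
    obtain k where k: "q dvd u - k * \<theta> x m" "q dvd v - k * \<theta> y m"
      using uv(1) by (auto simp: congruence_lattice_def q_def)
    have "\<theta> z m mod q = (u * \<theta> y m - v * \<theta> x m) mod q"
      unfolding z_uv using alg
      by (simp only: \<theta>(1-3) closed q_def[symmetric] mod_simps) (simp add: mod_simps)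
    also have "u * \<theta> y m - v * \<theta> x m = (u - k * \<theta> x m) * \<theta> y m - (v - k * \<theta> y m) * \<theta> x m"
      by (simp add: algebra_simps)
    finally show ?thesis using k by (metis dvd_diff dvd_mult2 dvd_eq_mod_eq_0)
  qed
  then have "q dvd \<theta> (z * z') m"
    unfolding \<theta>(2)[OF alg(3,4)] q_def[symmetric] by (simp add: dvd_mod_iff)
  then have dvd: "q dvd e * e + r * e * g - s * g * g"
    unfolding zz' \<theta>(3) q_def[symmetric] by (simp add: dvd_mod_iff)
  have "z \<noteq> 0"
  proof
    assume z0: "z = 0"
    have "g = 0"
    proof (rule ccontr)
      assume "g \<noteq> 0"
      then have "\<omega> = of_rat (of_int (- e) / of_int g)"
        using z0 by (simp add: z_def of_rat_divide of_rat_minus field_simps add_eq_0_iff)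
      then show False using \<omega>(3) by blast
    qed
    then have "e = 0" using z0 by (simp add: z_def)
    \<comment> \<open>Cramer's rule for the system that defines \<open>e\<close> and \<open>g\<close>\<close>
    have "(a * d - b * c) * u = a * g - b * e" "(a * d - b * c) * v = c * g - d * e"
      by (simp_all add: e_def g_def algebra_simps)
    then show False using \<open>e = 0\<close> \<open>g = 0\<close> indep uv(2) by simp
  qed
  then have "\<sigma>1 z * \<sigma>2 z \<noteq> 0"
    using type_ring_hom_eq_0_iff[OF sig(1)] type_ring_hom_eq_0_iff[OF sig(2)] by simp
  then have "e * e + r * e * g - s * g * g \<noteq> 0" unfolding sz by (metis of_int_0)
  then have "q \<le> \<bar>e * e + r * e * g - s * g * g\<bar>"
    using dvd by (metis abs_ge_zero dvd_abs_iff zdvd_imp_le zero_less_abs_iff)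
  then have "real_of_int q \<le> \<bar>\<sigma>1 z\<bar> * \<bar>\<sigma>2 z\<bar>"
    by (metis abs_mult of_int_abs of_int_le_iff sz)
  also have "\<dots> \<le> (max \<bar>u\<bar> \<bar>v\<bar> * (\<bar>\<sigma>1 x\<bar> + \<bar>\<sigma>1 y\<bar>)) * (max \<bar>u\<bar> \<bar>v\<bar> * (\<bar>\<sigma>2 x\<bar> + \<bar>\<sigma>2 y\<bar>))"
  proof -
    have "\<bar>f z\<bar> \<le> max \<bar>u\<bar> \<bar>v\<bar> * (\<bar>f x\<bar> + \<bar>f y\<bar>)" if f: "f \<in> ring_hom type_ring type_ring" for f :: "'l \<Rightarrow> real"
    proof -
      have "f z = of_int u * f y + of_int (- v) * f x"
        unfolding z_uv by (simp only: type_ring_hom_simps[OF f])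
      then have "\<bar>f z\<bar> \<le> \<bar>real_of_int u\<bar> * \<bar>f y\<bar> + \<bar>real_of_int v\<bar> * \<bar>f x\<bar>"
        using abs_triangle_ineq[of "of_int u * f y" "of_int (- v) * f x"] by (simp add: abs_mult)
      also have "\<dots> \<le> max \<bar>u\<bar> \<bar>v\<bar> * \<bar>f y\<bar> + max \<bar>u\<bar> \<bar>v\<bar> * \<bar>f x\<bar>"
        by (intro add_mono mult_right_mono) (auto simp: of_int_max)
      finally show ?thesis by (simp add: algebra_simps)
    qed
    then show ?thesis using sig by (intro mult_mono) auto
  qed
  also have "\<dots> = ((\<bar>\<sigma>1 x\<bar> + \<bar>\<sigma>1 y\<bar>) * (\<bar>\<sigma>2 x\<bar> + \<bar>\<sigma>2 y\<bar>)) * (real_of_int (max \<bar>u\<bar> \<bar>v\<bar>))\<^sup>2"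
    by (simp add: power2_eq_square)
  finally show ?thesis by (simp add: q_def)
qed

section \<open>Mesh ratio and nestedness\<close>

text \<open>Here \<open>\<delta>\<close> stands for \<open>p\<close> to the power \<open>- m / 2\<close>. The first conclusion only weakens the
  hypothesis on \<open>h\<close>, since \<open>eta * A \<ge> 1\<close>; the second one divides that hypothesis by the bound for \<open>q\<close> and uses \<open>\<surd>D \<le> A\<close>.\<close>

lemma mesh_bounds_combine:
  fixes h q A D \<delta> :: real
  defines "A \<equiv> 2 * sqrt D / sqrt 3"
  assumes "D > 0" "\<delta> > 0" and q: "1 / (2 * sqrt D) * \<delta> \<le> q"
    and h: "h \<le> (1 + sqrt 2) * ((eta + A) / 2 * \<delta>)" and A: "eta \<le> A"
  shows "h \<le> (1 + sqrt 2) * eta * A * (eta + A) / 2 * \<delta>"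
    and "h / q \<le> (1 + sqrt 2) * A * (eta + A)"
proof -
  define H where "H = (1 + sqrt 2) * ((eta + A) / 2 * \<delta>)"
  have A1: "1 < A" "1 < eta" using A eta_gt_1 by simp_all
  have Hpos: "0 < H" using A1 \<open>\<delta> > 0\<close> by (simp add: H_def add_pos_pos)
  have "1 * 1 \<le> eta * A" using A1 by (intro mult_mono) auto
  then have "1 * H \<le> (eta * A) * H" using Hpos by (intro mult_right_mono) auto
  also have "\<dots> = (1 + sqrt 2) * eta * A * (eta + A) / 2 * \<delta>" by (simp add: H_def)
  finally show "h \<le> (1 + sqrt 2) * eta * A * (eta + A) / 2 * \<delta>" using h by (simp add: H_def)
  define q0 where "q0 = 1 / (2 * sqrt D) * \<delta>"
  have q0: "0 < q0" using \<open>D > 0\<close> \<open>\<delta> > 0\<close> by (simp add: q0_def)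
  have qp: "0 < q" using q0 q by (simp add: q0_def)
  have "h / q \<le> H / q" using h[folded H_def] qp by (intro divide_right_mono) auto
  also have "\<dots> \<le> H / q0" using q[folded q0_def] q0 qp Hpos by (intro divide_left_mono) auto
  also have "\<dots> = (1 + sqrt 2) * (eta + A) * sqrt D"
    using \<open>D > 0\<close> \<open>\<delta> > 0\<close> by (simp add: H_def q0_def)
  also have "\<dots> \<le> (1 + sqrt 2) * (eta + A) * A"
  proof (rule mult_left_mono)
    have "sqrt 3 \<le> 2" by (rule real_le_lsqrt) auto
    then have "sqrt D * sqrt 3 \<le> sqrt D * 2" using \<open>D > 0\<close> by (intro mult_left_mono) auto
    then show "sqrt D \<le> A" by (simp add: A_def field_simps)
  qed (use A1 in \<open>simp add: add_nonneg_nonneg\<close>)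
  finally show "h / q \<le> (1 + sqrt 2) * A * (eta + A)" by (simp only: mult_ac)
qed

lemma powr_neg_half: "p > 0 \<Longrightarrow> real p powr (- real m / 2) = 1 / sqrt (real (p ^ m))"
proof -
  assume p: "p > 0"
  have "real p powr (- real m / 2) = (real p powr real m) powr (- (1 / 2))"
    by (simp add: powr_powr)
  also have "\<dots> = 1 / sqrt (real (p ^ m))"
    using p by (simp add: powr_minus powr_half_sqrt powr_realpow inverse_eq_divide)
  finally show ?thesis .
qed

lemma coord_proj_quadratic_points:
  "coord_proj i j (quadratic_points p \<omega> P \<phi> V m) = projected_lattice (p ^ m)
     (padic_embedding P \<phi> (config_beta \<omega> V i) m) (padic_embedding P \<phi> (config_beta \<omega> V j) m)"
  by (simp add: coord_proj_def quadratic_points_def rank1_lattice_def projected_lattice_def fun_eq_iff)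

text \<open>The point with label \<open>n\<close> at level \<open>m\<close> is the point with label \<open>p n\<close> at level \<open>m + 1\<close>.\<close>

lemma rank1_lattice_nested:
  assumes p: "p > 0" and z: "\<And>j. z' j mod int p ^ m = z j"
  shows "rank1_lattice (p ^ m) z ` {..<p ^ m} \<subseteq> rank1_lattice (p ^ Suc m) z' ` {..<p ^ Suc m}"
proof (rule image_subsetI)
  fix n assume n: "n \<in> {..<p ^ m}"
  have "rank1_lattice (p ^ m) z n = rank1_lattice (p ^ Suc m) z' (p * n)"
  proof (simp only: rank1_lattice_def vec_eq_iff vec_lambda_beta, rule allI)
    fix j
    have "int p ^ m dvd z j - z' j"
      using z[of j] by (metis mod_mod_trivial mod_eq_dvd_iff)
    then have "int (p ^ m) dvd int n * z j - int n * z' j"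
      by (simp add: right_diff_distrib[symmetric])
    then have "frac (real_of_int (int n * z j) / real (p ^ m)) = frac (real_of_int (int n * z' j) / real (p ^ m))"
      using p by (intro frac_div_shift) auto
    also have "real_of_int (int n * z' j) / real (p ^ m) = real_of_int (int (p * n) * z' j) / real (p ^ Suc m)"
      using p by simp
    finally show "frac (real_of_int (int n * z j) / real (p ^ m))
        = frac (real_of_int (int (p * n) * z' j) / real (p ^ Suc m))" .
  qed
  moreover have "p * n \<in> {..<p ^ Suc m}" using n p by simp
  ultimately show "rank1_lattice (p ^ m) z n \<in> rank1_lattice (p ^ Suc m) z' ` {..<p ^ Suc m}" by blast
qed

text \<open>The residues of \<open>\<theta> x\<close> modulo the powers of \<open>p\<close> are compatible, so being prime
  to \<open>p\<close> is decided modulo \<open>p\<close>.\<close>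

lemma padic_unit_coprime:
  assumes hom: "\<theta> \<in> ring_hom ring_of_integers (padic_integers p)"
    and p: "Factorial_Ring.prime p" and x: "algebraic_int x" and unit: "\<theta> x (Suc 0) \<noteq> 0"
  shows "coprime (\<theta> x m) (int (p ^ m))"
proof (cases m)
  case (Suc k)
  have "\<theta> x (Suc k) mod int p = \<theta> x (Suc 0)" for k
  proof (induction k)
    case 0
    then show ?case using padic_hom_simps(4)[OF hom x, of "Suc 0"] by simp
  next
    case (Suc k)
    have "\<theta> x (Suc (Suc k)) mod int p = \<theta> x (Suc (Suc k)) mod int p ^ Suc k mod int p"
      by (rule mod_mod_cancel[symmetric]) simp
    then show ?case using padic_hom_simps(5)[OF hom x, of "Suc k"] Suc by simp
  qed
  then have "\<not> int p dvd \<theta> x m" using unit Suc by (metis dvd_eq_mod_eq_0)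
  then have "coprime (int p) (\<theta> x m)" using p by (intro prime_imp_coprime) auto
  then show ?thesis by (simp add: coprime_commute)
qed simp
section \<open>Quasi-uniformity of the two-dimensional projections\<close>

theorem theorem4p6:
  fixes \<omega> :: "'l::field_char_0"
    and p :: nat
    and P :: "'l set"
    and \<tau> :: "'l \<Rightarrow> 'l"
    and \<sigma> :: "nat \<Rightarrow> 'l \<Rightarrow> real"
    and \<phi> :: "(nat \<Rightarrow> 'l set) \<Rightarrow> nat \<Rightarrow> int"
    and V :: "'d::{finite,linorder} \<Rightarrow> (rat \<times> rat) set"
  defines "OL \<equiv> (ring_of_integers :: 'l ring)"
    and "\<beta> \<equiv> config_beta \<omega> V"
    and "Pts \<equiv> quadratic_points p \<omega> P \<phi> V"
  assumes quadratic: "real_quadratic_field TYPE('l)"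
    and L_gen: "generate_field type_ring {\<omega>} = (UNIV :: 'l set)"
    and OL_gen: "carrier OL = generate_ring type_ring {\<omega>}"
    and sigma: "bij_betw \<sigma> {1..2} real_embeddings"
    and conj: "nontrivial_automorphism \<tau>"
    and p_prime: "Factorial_Ring.prime p"
    and P_prime: "primeideal P OL"
    and split: "PIdl\<^bsub>OL\<^esub> (of_nat p) = P \<cdot>\<^bsub>OL\<^esub> (\<tau> ` P)" "P \<noteq> \<tau> ` P"
    and completion: "\<phi> \<in> ring_iso (adic_completion OL P) (padic_integers p)"
    and d_ge_2: "CARD('d) \<ge> 2"
    and config: "coeff_configuration V"
    and adm: "admissible \<omega> P V"
  shows "(\<forall>m\<ge>1. Pts m ` {..<p ^ m} \<subseteq> Pts (m + 1) ` {..<p ^ (m + 1)}) \<and>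
    (\<forall>i j. i < j \<longrightarrow> quasi_uniform (\<lambda>m. p ^ m) (\<lambda>m. coord_proj i j (Pts m))) \<and>
    (\<forall>m\<ge>1. \<forall>i j. i < j \<longrightarrow>
       separation_radius (p ^ m) (coord_proj i j (Pts m))
         \<ge> 1 / (2 * sqrt (D_const \<sigma> \<beta> i j)) * real p powr (- real m / 2) \<and>
       fill_distance (p ^ m) (coord_proj i j (Pts m))
         \<le> (1 + sqrt 2) * eta * A_const \<sigma> \<beta> i j * (eta + A_const \<sigma> \<beta> i j) / 2
             * real p powr (- real m / 2) \<and>
       mesh_ratio (p ^ m) (coord_proj i j (Pts m))
         \<le> ereal ((1 + sqrt 2) * A_const \<sigma> \<beta> i j * (eta + A_const \<sigma> \<beta> i j))) \<and>
    (SUP m\<in>{1..}. Max ((\<lambda>(i, j). mesh_ratio (p ^ m) (coord_proj i j (Pts m)))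
                          ` {(i, j). i < j})) < \<infinity>"
proof -
  define \<theta> where "\<theta> = padic_embedding P \<phi>"
  interpret primeideal P OL by fact
  note cringOL = is_cring[unfolded OL_def]
  note primeP = P_prime[unfolded OL_def] and iso = completion[unfolded OL_def]
  have p0: "p > 0" "p \<ge> 2" using p_prime prime_gt_0_nat prime_ge_2_nat by auto
  have hom: "\<theta> \<in> ring_hom ring_of_integers (padic_integers p)"
    unfolding \<theta>_def by (rule padic_embedding_hom[OF primeP iso])
  have \<sigma>: "\<sigma> 1 \<in> ring_hom type_ring type_ring" "\<sigma> 2 \<in> ring_hom type_ring type_ring"
    using bij_betwE[OF sigma] by (auto simp: real_embeddings_def)
  obtain r s :: int where \<omega>: "\<omega> * \<omega> = of_int r * \<omega> + of_int s"
      "\<sigma> 1 \<omega> + \<sigma> 2 \<omega> = of_int r" "\<sigma> 1 \<omega> * \<sigma> 2 \<omega> = - of_int s" "\<And>q. \<omega> \<noteq> of_rat q"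
    using generator_relation_over_int[OF quadratic L_gen OL_gen[unfolded OL_def] sigma conj] by blast
  have \<omega>_int: "algebraic_int \<omega>"
    using OL_gen generate_ring.incl[of \<omega> "{\<omega>}" type_ring] by (auto simp: OL_def)
  have \<beta>_int: "algebraic_int (\<beta> j)" for j
    unfolding \<beta>_def config_beta_def
    by (auto split: prod.split intro!: ring_of_integers_closed[OF cringOL] \<omega>_int)
  have p_in_P: "of_nat p \<in> P"
  proof -
    have "of_nat p \<in> PIdl\<^bsub>OL\<^esub> (of_nat p)" by (rule cgenideal_self) (simp add: OL_def)
    moreover have "x \<in> P" if "x \<in> P \<cdot>\<^bsub>OL\<^esub> (\<tau> ` P)" for x
      using that
    proof induction
      case (prod i j)
      have "\<tau> \<in> ring_hom type_ring type_ring"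
        using conj by (auto simp: nontrivial_automorphism_def ring_iso_def)
      then have "j \<in> carrier OL"
        using prod(2) Icarr algebraic_int_hom by (auto simp: OL_def)
      then show ?case using prod(1) by (intro I_r_closed)
    next
      case (sum x y)
      then show ?case by simp
    qed
    ultimately show ?thesis using split(1) by blast
  qed
  have \<beta>_unit: "\<theta> (\<beta> j) (Suc 0) \<noteq> 0" for j
    using padic_embedding_nonunit[OF primeP iso p0(1) p_in_P \<beta>_int[of j]] adm
    by (auto simp: admissible_def \<beta>_def \<theta>_def)
  have \<beta>_nz: "\<beta> j \<noteq> 0" for j
    using adm additive_subgroup.zero_closed[OF is_additive_subgroup]
    by (metis OL_def ring_of_integers_simps(5) \<beta>_def admissible_def)
  have nested: "Pts m ` {..<p ^ m} \<subseteq> Pts (m + 1) ` {..<p ^ (m + 1)}" for m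
    unfolding Pts_def quadratic_points_def Suc_eq_plus1[symmetric]
    by (rule rank1_lattice_nested[OF p0(1)]) (rule padic_hom_simps(5)[OF hom \<beta>_int, unfolded \<theta>_def \<beta>_def])
  define C where "C i j = (1 + sqrt 2) * A_const \<sigma> \<beta> i j * (eta + A_const \<sigma> \<beta> i j)" for i j
  have bounds: "separation_radius (p ^ m) (coord_proj i j (Pts m))
         \<ge> 1 / (2 * sqrt (D_const \<sigma> \<beta> i j)) * real p powr (- real m / 2)" (is "?q \<ge> _")
    "fill_distance (p ^ m) (coord_proj i j (Pts m))
         \<le> (1 + sqrt 2) * eta * A_const \<sigma> \<beta> i j * (eta + A_const \<sigma> \<beta> i j) / 2
             * real p powr (- real m / 2)" (is "?h \<le> _")
    "mesh_ratio (p ^ m) (coord_proj i j (Pts m)) \<le> ereal (C i j)"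
    if m: "m \<ge> 1" and ij: "i < j" for m i j
  proof -
    define D where "D = D_const \<sigma> \<beta> i j"
    define N where "N = p ^ m"
    have D: "D = (\<bar>\<sigma> 1 (\<beta> i)\<bar> + \<bar>\<sigma> 1 (\<beta> j)\<bar>) * (\<bar>\<sigma> 2 (\<beta> i)\<bar> + \<bar>\<sigma> 2 (\<beta> j)\<bar>)"
      by (simp add: D_def D_const_def numeral_2_eq_2)
    have "\<sigma> 1 (\<beta> i) \<noteq> 0" "\<sigma> 2 (\<beta> i) \<noteq> 0"
      using \<beta>_nz type_ring_hom_eq_0_iff[OF \<sigma>(1)] type_ring_hom_eq_0_iff[OF \<sigma>(2)] by auto
    then have Dpos: "D > 0" unfolding D by (intro mult_pos_pos add_pos_nonneg) auto
    have N2: "N \<ge> 2"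
      using p0(2) m self_le_power[of p m] unfolding N_def by linarith
    define a b where "a = \<theta> (\<beta> i) m" and "b = \<theta> (\<beta> j) m"
    have cop: "coprime a (int N)"
      unfolding a_def N_def by (rule padic_unit_coprime[OF hom p_prime \<beta>_int \<beta>_unit])
    obtain a1 b1 where ri: "canonical_rep (V i) = (a1, b1)" by fastforce
    obtain a2 b2 where rj: "canonical_rep (V j) = (a2, b2)" by fastforce
    have \<beta>ij: "\<beta> i = of_int a1 + of_int b1 * \<omega>" "\<beta> j = of_int a2 + of_int b2 * \<omega>"
      by (simp_all add: \<beta>_def config_beta_def ri rj)
    have indep: "a1 * b2 \<noteq> b1 * a2"
      using configuration_independent[OF config _ ri rj] ij by simp
    have short: "real N \<le> D * (real_of_int (max \<bar>u\<bar> \<bar>v\<bar>))\<^sup>2"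
      if "(u, v) \<in> congruence_lattice (int N) a b" "(u, v) \<noteq> (0, 0)" for u v
      using short_vector_bound[OF cringOL hom \<sigma> \<omega>_int \<omega>(1,4,2,3) \<beta>ij indep, of u v m] that
      unfolding D N_def a_def b_def by simp
    have Y: "coord_proj i j (Pts m) = projected_lattice N a b"
      by (simp add: Pts_def coord_proj_quadratic_points N_def a_def b_def \<theta>_def \<beta>_def)
    define \<delta> where "\<delta> = real p powr (- real m / 2)"
    have \<delta>: "\<delta> = 1 / sqrt N" unfolding \<delta>_def N_def by (rule powr_neg_half[OF p0(1)])
    have \<delta>pos: "\<delta> > 0" using N2 by (simp add: \<delta>)
    have A: "A_const \<sigma> \<beta> i j = 2 * sqrt D / sqrt 3" by (simp add: A_const_def D_def)
    have q: "1 / (2 * sqrt D) * \<delta> \<le> ?q"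
      using separation_radius_ge[where b = b, OF N2 cop Dpos short]
      unfolding Y \<delta> N_def[symmetric] by simp
    have h: "?h \<le> (1 + sqrt 2) * ((eta + 2 * sqrt D / sqrt 3) / 2 * \<delta>)"
      using fill_distance_lattice_le(1)[where b = b, OF N2 cop Dpos short]
      unfolding Y \<delta> N_def[symmetric] by simp
    have etaA: "eta \<le> 2 * sqrt D / sqrt 3"
      using fill_distance_lattice_le(2)[where b = b, OF N2 cop Dpos short] by simp
    note comb = mesh_bounds_combine[OF Dpos \<delta>pos q h etaA]
    show "?q \<ge> 1 / (2 * sqrt (D_const \<sigma> \<beta> i j)) * real p powr (- real m / 2)"
      using q by (simp only: D_def \<delta>_def)
    show "?h \<le> (1 + sqrt 2) * eta * A_const \<sigma> \<beta> i j * (eta + A_const \<sigma> \<beta> i j) / 2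
             * real p powr (- real m / 2)"
      using comb(1) by (simp only: A \<delta>_def)
    have "0 < 1 / (2 * sqrt D) * \<delta>" using Dpos \<delta>pos by simp
    then have "?q \<noteq> 0" using q by linarith
    then show "mesh_ratio (p ^ m) (coord_proj i j (Pts m)) \<le> ereal (C i j)"
      using comb(2) by (simp add: mesh_ratio_def C_def A)
  qed
  have qu: "quasi_uniform (\<lambda>m. p ^ m) (\<lambda>m. coord_proj i j (Pts m))" if "i < j" for i j
    unfolding quasi_uniform_def using bounds(3)[OF _ that] by blast
  have "(SUP m\<in>{1..}. Max ((\<lambda>(i, j). mesh_ratio (p ^ m) (coord_proj i j (Pts m)))
                          ` {(i, j). i < j})) < \<infinity>"
  proof -
    let ?I = "{(i, j). i < j} :: ('d \<times> 'd) set"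
    obtain k l :: 'd where "k \<noteq> l"
    proof -
      have "\<not> (\<forall>k l :: 'd. k = l)"
      proof
        assume "\<forall>k l :: 'd. k = l"
        then have "CARD('d) \<le> 1" by (simp add: card_le_Suc0_iff_eq)
        then show False using d_ge_2 by simp
      qed
      then show ?thesis using that by blast
    qed
    then have "(k, l) \<in> ?I \<or> (l, k) \<in> ?I" by auto
    then have ne: "?I \<noteq> {}" by blast
    \<comment> \<open>the pairwise constants do not depend on \<open>m\<close>, and there are finitely many pairs\<close>
    define B where "B = Max ((\<lambda>(i, j). C i j) ` ?I)"
    have "(SUP m\<in>{1..}. Max ((\<lambda>(i, j). mesh_ratio (p ^ m) (coord_proj i j (Pts m))) ` ?I)) \<le> ereal B"
    proof (rule SUP_least)
      fix m :: nat assume m: "m \<in> {1..}"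
      show "Max ((\<lambda>(i, j). mesh_ratio (p ^ m) (coord_proj i j (Pts m))) ` ?I) \<le> ereal B"
      proof (rule Max.boundedI)
        fix x assume "x \<in> (\<lambda>(i, j). mesh_ratio (p ^ m) (coord_proj i j (Pts m))) ` ?I"
        then obtain i j where ij: "i < j" and x: "x = mesh_ratio (p ^ m) (coord_proj i j (Pts m))"
          by auto
        have "x \<le> ereal (C i j)" unfolding x using m ij by (intro bounds(3)) auto
        also have "C i j \<le> B" unfolding B_def using ij by (intro Max_ge) auto
        finally show "x \<le> ereal B" by simp
      qed (use ne in auto)
    qed
    then show ?thesis by (rule le_less_trans) simp
  qed
  then show ?thesis
    by (intro conjI allI impI nested qu bounds[unfolded C_def])
qed

end
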